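(* Let $\mathbb{F}=\mathbb{C}$ or $\mathbb{F}=\mathbb{R}$ and let $\mathcal{L}:\mathbb{F}^{q\times q}\to\mathbb{F}^{n\times n}$ be a $*$-linear map with matricization $L=[L_{ij}]$ (blocks $L_{ij}\in\mathbb{F}^{n\times q}$, $1\le i\le n$, $1\le j\le q$) and Choi matrix $\mathbb{L}$. Set $m=\operatorname{rank}\mathbb{L}$. Assume one can choose linearly independent $L_1,\ldots,L_m\in\mathbb{F}^{n\times q}$ among the block entries of $L$, say $L_k=L_{i_kj_k}$ for $k=1,\ldots,m$, in such a way that (C1) for each $k$ we have $j_l\neq j_k$ for each $l\neq k$, or $i_l\neq i_k$ for each $l\neq k$. Assume further that all other block entries of $L$ (those $L_{ij}$ with $(i,j)\neq(i_k,j_k)$ for all $k$) are equal to a single matrix $L_0$ in the span of $L_1,\ldots,L_m$. Then $\mathcal{L}$ is completely positive if and only if $\mathcal{L}$ is positive.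
   Context: Notation: $^*$ denotes the adjoint (the transpose when $\mathbb{F}=\mathbb{R}$), and Hermitian means symmetric when $\mathbb{F}=\mathbb{R}$. A linear map $\mathcal{L}:\mathbb{F}^{q\times q}\to\mathbb{F}^{n\times n}$ is $*$-linear if $\mathcal{L}(V^* )=\mathcal{L}(V)^*$ for all $V\in\mathbb{F}^{q\times q}$; positive if it maps positive semidefinite (Hermitian) matrices to positive semidefinite matrices; completely positive if for every $k\ge1$ the map $[V_{ab}]_{a,b=1}^k\mapsto[\mathcal{L}(V_{ab})]_{a,b=1}^k$ is positive (equivalently, the Choi matrix is positive semidefinite). The Choi matrix of $\mathcal{L}$ is $\mathbb{L}=[\mathbb{L}_{ij}]_{i,j=1}^q\in\mathbb{F}^{nq\times nq}$ with $\mathbb{L}_{ij}=\mathcal{L}(\mathcal{E}_{ij}^{(q)})\in\mathbb{F}^{n\times n}$, where $\mathcal{E}_{ij}^{(q)}$ is the $q\times q$ matrix with a $1$ in position $(i,j)$ and zeros elsewhere. With $\operatorname{vec}$ the operator stacking the columns of a matrix, the matricization of $\mathcal{L}$ is the matrix $L\in\mathbb{F}^{n^2\times q^2}$ with $L\operatorname{vec}(V)=\operatorname{vec}(\mathcal{L}(V))$ for all $V\in\mathbb{F}^{q\times q}$; it is partitioned as an $n\times q$ block matrix $L=[L_{ij}]$ with blocks $L_{ij}\in\mathbb{F}^{n\times q}$, $i=1,\ldots,n$, $j=1,\ldots,q$. (One has $\operatorname{rank}\mathbb{L}=\dim\operatorname{span}\{L_{ij}\}$.) *)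

theory Defs
  imports "Jordan_Normal_Form.Schur_Decomposition" "Jordan_Normal_Form.DL_Rank"
begin

text \<open>
  Everything below is polymorphic in the scalars; only the instances \<^typ>\<open>real\<close> (where
  \<^const>\<open>conjugate\<close> is the identity, so \<^const>\<open>mat_adjoint\<close> is the transpose)
  and \<^typ>\<open>complex\<close> are of interest.  As in the matrix library, all row, column, block and
  family indices start at 0.
\<close>

text \<open>
  On \<^typ>\<open>complex\<close> the order is the one of \<^theory>\<open>HOL-Library.Complex_Order\<close>: \<open>0 \<le> z\<close> means that
  \<open>z\<close> is real and nonnegative.  The scalar product \<open>(A *\<^sub>v x) \<bullet>c x\<close> is \<open>x\<^sup>* A x\<close>.
\<close>

definition psd :: "nat \<Rightarrow> 'a::conjugatable_ordered_field mat \<Rightarrow> bool" where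
  "psd d A \<longleftrightarrow> A \<in> carrier_mat d d \<and> mat_adjoint A = A \<and>
     (\<forall>x \<in> carrier_vec d. 0 \<le> (A *\<^sub>v x) \<bullet>c x)"

definition star_linear :: "nat \<Rightarrow> nat \<Rightarrow> ('a::conjugatable_field mat \<Rightarrow> 'a mat) \<Rightarrow> bool" where
  "star_linear q n \<L> \<longleftrightarrow>
     linear_map class_ring (module_mat TYPE('a) q q) (module_mat TYPE('a) n n) \<L> \<and>
     (\<forall>V \<in> carrier_mat q q. \<L> (mat_adjoint V) = mat_adjoint (\<L> V))"

definition positive_map ::
    "nat \<Rightarrow> nat \<Rightarrow> ('a::conjugatable_ordered_field mat \<Rightarrow> 'a mat) \<Rightarrow> bool" where
  "positive_map q n \<L> \<longleftrightarrow> (\<forall>V. psd q V \<longrightarrow> psd n (\<L> V))"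

text \<open>The block in block position \<open>(i, j)\<close> of a matrix cut into blocks of size \<open>r \<times> c\<close>.\<close>

definition block :: "nat \<Rightarrow> nat \<Rightarrow> 'a mat \<Rightarrow> nat \<Rightarrow> nat \<Rightarrow> 'a mat" where
  "block r c M i j = mat r c (\<lambda>(a, b). M $$ (i * r + a, j * c + b))"

text \<open>The \<open>k \<times> k\<close> block matrix with blocks \<open>B i j\<close> of size \<open>d \<times> d\<close>.\<close>

definition of_blocks :: "nat \<Rightarrow> nat \<Rightarrow> (nat \<Rightarrow> nat \<Rightarrow> 'a mat) \<Rightarrow> 'a mat" where
  "of_blocks k d B = mat (k * d) (k * d) (\<lambda>(r, c). B (r div d) (c div d) $$ (r mod d, c mod d))"

definition completely_positive ::
    "nat \<Rightarrow> nat \<Rightarrow> ('a::conjugatable_ordered_field mat \<Rightarrow> 'a mat) \<Rightarrow> bool" where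
  "completely_positive q n \<L> \<longleftrightarrow>
     (\<forall>k\<ge>1. positive_map (k * q) (k * n) (\<lambda>V. of_blocks k n (\<lambda>a b. \<L> (block q q V a b))))"

definition matrix_unit :: "nat \<Rightarrow> nat \<Rightarrow> nat \<Rightarrow> 'a::zero_neq_one mat" where
  "matrix_unit q i j = mat q q (\<lambda>p. if p = (i, j) then 1 else 0)"

definition choi :: "nat \<Rightarrow> nat \<Rightarrow> ('a::zero_neq_one mat \<Rightarrow> 'a mat) \<Rightarrow> 'a mat" where
  "choi q n \<L> = of_blocks q n (\<lambda>i j. \<L> (matrix_unit q i j))"

text \<open>The operator vec, which stacks the columns of a matrix.\<close>

definition stack_cols :: "'a mat \<Rightarrow> 'a vec" where
  "stack_cols A = vec (dim_row A * dim_col A) (\<lambda>p. A $$ (p mod dim_row A, p div dim_row A))"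

definition is_matricization ::
    "nat \<Rightarrow> nat \<Rightarrow> ('a::semiring_0 mat \<Rightarrow> 'a mat) \<Rightarrow> 'a mat \<Rightarrow> bool" where
  "is_matricization q n \<L> L \<longleftrightarrow> L \<in> carrier_mat (n\<^sup>2) (q\<^sup>2) \<and>
     (\<forall>V \<in> carrier_mat q q. L *\<^sub>v stack_cols V = stack_cols (\<L> V))"

text \<open>
  Linear independence of the family \<open>B 0, \<dots>, B (m - 1)\<close>: the library notion concerns sets, so
  repetitions have to be excluded separately.
\<close>

definition lin_indpt_family :: "nat \<Rightarrow> nat \<Rightarrow> nat \<Rightarrow> (nat \<Rightarrow> 'a::field mat) \<Rightarrow> bool" where
  "lin_indpt_family nr nc m B \<longleftrightarrow> inj_on B {..<m} \<and>
     \<not> LinearCombinations.module.lin_dep class_ring (module_mat TYPE('a) nr nc) (B ` {..<m})"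

definition mat_span :: "nat \<Rightarrow> nat \<Rightarrow> 'a::field mat set \<Rightarrow> 'a mat set" where
  "mat_span nr nc S = LinearCombinations.module.span class_ring (module_mat TYPE('a) nr nc) S"

text \<open>Condition (C1) on the block positions \<open>(i k, j k)\<close>, \<open>k < m\<close>.\<close>

definition cond_C1 :: "nat \<Rightarrow> (nat \<Rightarrow> nat) \<Rightarrow> (nat \<Rightarrow> nat) \<Rightarrow> bool" where
  "cond_C1 m i j \<longleftrightarrow>
     (\<forall>k<m. (\<forall>l<m. l \<noteq> k \<longrightarrow> j l \<noteq> j k) \<or> (\<forall>l<m. l \<noteq> k \<longrightarrow> i l \<noteq> i k))"

end

theory Submission
  imports Defs
begin

text \<open>
  Let \<open>s k = (i k, j k)\<close> be the chosen block positions. The entries of the block \<open>(i, j)\<close> form one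
  column of the Choi matrix, which is Hermitian. All columns are combinations of the chosen ones, with
  coefficients \<open>T k (i, j)\<close>, so the Choi matrix is \<open>T\<^sup>* g T\<close>, where \<open>g\<close> is its principal submatrix at
  the chosen positions (\<open>completely_positive_iff_positive\<close>).

  If \<open>g\<close> is positive semidefinite, the map is completely positive: every value of the form of an image is
  the sum of the entrywise product of \<open>g\<close> with another positive semidefinite form, and such sums are
  nonnegative (\<open>Fejer_sum_nonneg\<close>, \<open>completely_positive_if_factored\<close>).

  Positivity of the map only says that \<open>g\<close> is nonnegative at the vectors \<open>T (z \<otimes> x)\<close>
  (\<open>nonneg_on_product_vectors\<close>). So the point is that these vectors are dense. By the assumption on the
  other blocks, \<open>T\<close> maps the matrix \<open>z a * x b\<close> to the vector with entries
  \<open>z (i k) * x (j k) + c k * \<sigma>\<close>, where \<open>\<sigma>\<close> is the sum of its entries off the chosen positions. By (C1)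
  the chosen positions are the edges of a forest of stars between rows and columns. Therefore the
  products \<open>z (i k) * x (j k)\<close> can be prescribed, and nonzero values at the centres of the stars remain
  free. It remains to choose these values such that \<open>\<sigma>\<close> is consistent. If all centres are on one side,
  the condition is linear in \<open>\<sigma>\<close> and solvable for a suitable choice (\<open>reachable_pure\<close>). If there are
  centres on both sides, only the product \<open>r\<close> of a row and a column centre matters, and the condition
  is quadratic in \<open>r\<close>; it can be solved for generic vectors over both fields (\<open>reachable_mixed\<close>,
  \<open>real_balance\<close>, \<open>complex_balance\<close>). A limit removes the genericity (\<open>nonneg_from_reachable\<close>).
\<close>

section \<open>The scalars\<close>

text \<open>
  Beyond the arithmetic of order and conjugation, real and complex scalars enter through two
  properties only. Nonnegativity is a closed condition, which allows passing from generic vectors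
  to all vectors. The second axiom is where the two fields behave differently: it says that one can
  adjust a product vector to a prescribed value when the chosen block positions contain stars with
  centres on both sides; see \<open>reachable_mixed\<close> for the meaning of the constants.
\<close>

class form_field = conjugatable_ordered_field + real_normed_field + ordered_comm_ring +
  assumes closed_nonneg: "closed {z. 0 \<le> z}"
    and balance_solvable: "A \<noteq> 0 \<Longrightarrow> B \<noteq> 0 \<Longrightarrow> 0 < p \<Longrightarrow> 0 < p' \<Longrightarrow>
      \<exists>\<sigma> r. r \<noteq> 0 \<and>
        \<sigma> = (of_nat p * r + (B - b * \<sigma>)) * (of_nat p' + (A - a * \<sigma>) / r)
            - (A - a * \<sigma>) - (B - b * \<sigma>)"

text \<open>
  For fixed \<open>\<sigma>\<close> the balance equation is a quadratic equation for \<open>r\<close>; here \<open>A\<close> and \<open>B\<close> stand for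
  the adjusted values \<open>A - a * \<sigma>\<close> and \<open>B - b * \<sigma>\<close>.
\<close>

lemma balance_equation:
  fixes A B P R r \<sigma> :: "'a::field"
  assumes "r \<noteq> 0"
    and "P * R * (r * r) - (\<sigma> - (P - 1) * A - (R - 1) * B) * r + A * B = 0"
  shows "\<sigma> = (P * r + B) * (R + A / r) - A - B"
proof -
  have "r * (\<sigma> - ((P * r + B) * (R + A / r) - A - B)) = 0"
    using assms by (simp add: field_simps)
  then show ?thesis using assms(1) by simp
qed

lemma real_quadratic_root:
  fixes l c p :: real
  assumes "p \<noteq> 0" "c \<noteq> 0" "0 \<le> l * l - 4 * p * c"
  shows "\<exists>r. r \<noteq> 0 \<and> p * (r * r) - l * r + c = 0"
proof -
  define d where "d = sqrt (l * l - 4 * p * c)"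
  have d: "d * d = l * l - 4 * p * c" using assms by (simp add: d_def)
  define r where "r = (l + d) / (2 * p)"
  have "4 * p * (p * (r * r) - l * r + c) = (2 * p * r) * (2 * p * r) - 2 * l * (2 * p * r) + 4 * p * c"
    by (simp add: algebra_simps)
  also have "2 * p * r = l + d" using assms(1) by (simp add: r_def)
  finally have "4 * p * (p * (r * r) - l * r + c) = 0" using d by (simp add: algebra_simps)
  then have "p * (r * r) - l * r + c = 0" using assms(1) by simp
  moreover from this have "r \<noteq> 0" using assms(2) by auto
  ultimately show ?thesis by blast
qed

text \<open>
  Over the reals \<open>\<sigma>\<close> has to be chosen so that the quadratic equation for \<open>r\<close> has a real nonzero root.
  If the product \<open>(A - a * \<sigma>) * (B - b * \<sigma>)\<close> is negative for some \<open>\<sigma>\<close>, the discriminant is positive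
  there. Otherwise this product either does not depend on \<open>\<sigma>\<close>, and then a large \<open>\<sigma>\<close> makes the
  discriminant positive, or both factors vanish at the same nonzero \<open>\<sigma>\<close>, where \<open>r\<close> is found from a
  linear equation.
\<close>

lemma real_balance:
  fixes A B a b :: real
  assumes "A \<noteq> 0" "B \<noteq> 0" "0 < p" "0 < p'"
  shows "\<exists>\<sigma> r. r \<noteq> 0 \<and>
        \<sigma> = (of_nat p * r + (B - b * \<sigma>)) * (of_nat p' + (A - a * \<sigma>) / r)
            - (A - a * \<sigma>) - (B - b * \<sigma>)"
proof -
  define P R where "P = (of_nat p :: real)" and "R = (of_nat p' :: real)"
  have PR: "P \<ge> 1" "R \<ge> 1" using assms by (auto simp: P_def R_def)
  then have PR0: "P * R > 0" by simp
  define l where "l \<sigma> = \<sigma> - (P - 1) * (A - a * \<sigma>) - (R - 1) * (B - b * \<sigma>)" for \<sigma>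
  have *: "\<exists>\<sigma> r. r \<noteq> 0 \<and> P * R * (r * r) - l \<sigma> * r + (A - a * \<sigma>) * (B - b * \<sigma>) = 0"
  proof (cases "\<exists>\<sigma>. (A - a * \<sigma>) * (B - b * \<sigma>) < 0")
    case True
    then obtain \<sigma> where s: "(A - a * \<sigma>) * (B - b * \<sigma>) < 0" by blast
    have "P * R * ((A - a * \<sigma>) * (B - b * \<sigma>)) \<le> 0"
      using s PR0 by (simp add: mult_pos_neg less_imp_le)
    then have "0 \<le> l \<sigma> * l \<sigma> - 4 * (P * R) * ((A - a * \<sigma>) * (B - b * \<sigma>))"
      using zero_le_square[of "l \<sigma>"] by linarith
    moreover have "P * R \<noteq> 0" "(A - a * \<sigma>) * (B - b * \<sigma>) \<noteq> 0" using PR0 s by linarith+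
    ultimately show ?thesis using real_quadratic_root by blast
  next
    case False
    then have nn: "0 \<le> (A - a * \<sigma>) * (B - b * \<sigma>)" for \<sigma> by (meson not_less)
    have "0 \<le> A * B" using nn[of 0] by simp
    moreover have "A * B \<noteq> 0" using assms by simp
    ultimately have AB: "0 < A * B" by linarith
    show ?thesis
    proof (cases "a = 0 \<and> b = 0")
      case True
      \<comment> \<open>the last summand becomes \<open>l \<sigma>\<close>, and \<open>(x + 1)\<^sup>2 \<ge> x\<close> for \<open>0 \<le> x\<close>\<close>
      define \<sigma> where "\<sigma> = (P - 1) * A + (R - 1) * B + (4 * (P * R) * (A * B) + 1)"
      have l: "l \<sigma> = 4 * (P * R) * (A * B) + 1" using True by (simp add: l_def \<sigma>_def)
      have "0 \<le> l \<sigma> * l \<sigma> - 4 * (P * R) * (A * B)"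
      proof -
        have pos: "0 \<le> 4 * (P * R) * (A * B)" using PR0 AB by simp
        have "l \<sigma> * l \<sigma> = (4 * (P * R) * (A * B))\<^sup>2 + 2 * (4 * (P * R) * (A * B)) + 1"
          unfolding l by (simp add: power2_eq_square algebra_simps)
        then show ?thesis using pos zero_le_power2[of "4 * (P * R) * (A * B)"] by linarith
      qed
      moreover have "P * R \<noteq> 0" "A * B \<noteq> 0" using PR0 AB by linarith+
      ultimately obtain r where "r \<noteq> 0" "P * R * (r * r) - l \<sigma> * r + A * B = 0"
        using real_quadratic_root by blast
      then show ?thesis using True by (intro exI[of _ \<sigma>] exI[of _ r]) simp
    next
      case False
      have parallel: "a * B = b * A"
      proof (rule ccontr)
        assume ne: "a * B \<noteq> b * A"
        show False
        proof (cases "a = 0 \<or> b = 0")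
          case True
          then show False
          proof
            assume a: "a = 0"
            with ne have "b \<noteq> 0" by auto
            \<comment> \<open>reflecting \<open>0\<close> at the only zero changes the sign of the product\<close>
            then have "(A - a * (2 * B / b)) * (B - b * (2 * B / b)) = - (A * B)"
              using a by (simp add: field_simps)
            with nn[of "2 * B / b"] AB show False by linarith
          next
            assume b: "b = 0"
            with ne have "a \<noteq> 0" by auto
            \<comment> \<open>again the reflection of \<open>0\<close>\<close>
            then have "(A - a * (2 * A / a)) * (B - b * (2 * A / a)) = - (A * B)"
              using b by (simp add: field_simps)
            with nn[of "2 * A / a"] AB show False by linarith
          qed
        next
          case False
          then have ab: "a \<noteq> 0" "b \<noteq> 0" by auto
          define u v where "u = A / a" and "v = B / b"
          have uv: "A = a * u" "B = b * v" using ab by (auto simp: u_def v_def)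
          have "u \<noteq> v" using ne uv ab by auto
          have ab': "0 \<le> a * b * ((u - \<sigma>) * (v - \<sigma>))" for \<sigma>
          proof -
            have "(A - a * \<sigma>) * (B - b * \<sigma>) = a * b * ((u - \<sigma>) * (v - \<sigma>))"
              unfolding uv by (simp add: algebra_simps)
            with nn[of \<sigma>] show ?thesis by simp
          qed
          \<comment> \<open>evaluation between the two zeros gives one sign of \<open>a * b\<close>, evaluation beyond them the other\<close>
          have "a * b * ((u - (u + v) / 2) * (v - (u + v) / 2)) = - (a * b) * ((u - v)\<^sup>2 / 4)"
            by (simp add: field_simps power2_eq_square)
          with ab'[of "(u + v) / 2"] have "0 \<le> - (a * b) * ((u - v)\<^sup>2 / 4)" by linarith
          moreover have "0 < (u - v)\<^sup>2 / 4" using \<open>u \<noteq> v\<close> by simp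
          ultimately have "a * b \<le> 0" by (metis neg_0_le_iff_le zero_le_mult_iff not_le)
          moreover have "0 \<le> a * b"
          proof -
            define w where "w = max u v + 1"
            have "0 < (u - w) * (v - w)" by (rule mult_neg_neg) (auto simp: w_def)
            with ab'[of w] show ?thesis by (metis zero_le_mult_iff not_le)
          qed
          ultimately have "a * b = 0" by linarith
          with ab show False by simp
        qed
      qed
      obtain \<sigma> where s: "A - a * \<sigma> = 0" "B - b * \<sigma> = 0"
      proof (cases "a = 0")
        case True
        then have "b \<noteq> 0" using False by simp
        then show ?thesis using parallel True assms by (intro that[of "B / b"]) auto
      next
        case a: False
        then show ?thesis using parallel by (intro that[of "A / a"]) (auto simp: field_simps)
      qed
      have "\<sigma> \<noteq> 0" using s assms by auto
      then have l: "l \<sigma> = \<sigma>" "\<sigma> / (P * R) \<noteq> 0" using s PR0 by (auto simp: l_def)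
      show ?thesis
        by (rule exI[of _ \<sigma>], rule exI[of _ "\<sigma> / (P * R)"]) (use s l PR0 in simp)
    qed
  qed
  then obtain \<sigma> r where r: "r \<noteq> 0" "P * R * (r * r) - l \<sigma> * r + (A - a * \<sigma>) * (B - b * \<sigma>) = 0"
    by blast
  from balance_equation[OF r[unfolded l_def]] r(1) show ?thesis
    unfolding P_def R_def by blast
qed

text \<open>
  Over the complex numbers \<open>\<sigma> = 0\<close> will do; the root \<open>r\<close> is nonzero because the constant term
  \<open>A * B\<close> of the quadratic is.
\<close>

lemma complex_balance:
  fixes A B a b :: complex
  assumes "A \<noteq> 0" "B \<noteq> 0" "0 < p" "0 < p'"
  shows "\<exists>\<sigma> r. r \<noteq> 0 \<and>
        \<sigma> = (of_nat p * r + (B - b * \<sigma>)) * (of_nat p' + (A - a * \<sigma>) / r)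
            - (A - a * \<sigma>) - (B - b * \<sigma>)"
proof -
  define P R where "P = (of_nat p :: complex)" and "R = (of_nat p' :: complex)"
  have PR: "P * R \<noteq> 0" using assms by (simp add: P_def R_def)
  define l where "l = 0 - (P - 1) * A - (R - 1) * B"
  define d where "d = csqrt (l * l - 4 * (P * R) * (A * B))"
  have d: "d * d = l * l - 4 * (P * R) * (A * B)"
    using power2_csqrt[of "l * l - 4 * (P * R) * (A * B)"] by (simp add: d_def power2_eq_square)
  define r where "r = (l + d) / (2 * (P * R))"
  have "4 * (P * R) * (P * R * (r * r) - l * r + A * B)
      = (2 * (P * R) * r) * (2 * (P * R) * r) - 2 * l * (2 * (P * R) * r) + 4 * (P * R) * (A * B)"
    by (simp add: algebra_simps)
  also have "2 * (P * R) * r = l + d" using PR by (simp add: r_def)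
  finally have "4 * (P * R) * (P * R * (r * r) - l * r + A * B) = 0"
    using d by (simp add: algebra_simps)
  then have e: "P * R * (r * r) - l * r + A * B = 0" using PR by simp
  have "r \<noteq> 0" using e assms by auto
  from balance_equation[OF this e[unfolded l_def]] \<open>r \<noteq> 0\<close> show ?thesis
    unfolding P_def R_def by (intro exI[of _ 0] exI[of _ r]) simp
qed

instance real :: form_field
proof
  show "closed {z::real. 0 \<le> z}" by (simp add: closed_Collect_le)
qed (rule real_balance)

instance complex :: form_field
proof
  have "{z::complex. 0 \<le> z} = {z. 0 \<le> Re z} \<inter> {z. Im z = 0}"
    by (auto simp: less_eq_complex_def)
  moreover have "closed \<dots>"
    by (intro closed_Int closed_Collect_le closed_Collect_eq continuous_intros)
  ultimately show "closed {z::complex. 0 \<le> z}" by simp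
qed (rule complex_balance)

section \<open>Values of product vectors on a star forest\<close>

lemma prescribed_sum:
  fixes t w :: "nat \<Rightarrow> 'a::comm_monoid_add"
  assumes "J \<subseteq> {..<q}" "j ` Q \<subseteq> {..<q}" "inj_on j Q" "J \<inter> j ` Q = {}"
  obtains x where "\<And>b. b \<in> J \<Longrightarrow> x b = t b" "\<And>k. k \<in> Q \<Longrightarrow> x (j k) = w k"
    "(\<Sum>b<q. x b) = (\<Sum>b\<in>J. t b) + (\<Sum>k\<in>Q. w k)"
proof -
  define x where "x b = (if b \<in> J then t b else if b \<in> j ` Q then w (the_inv_into Q j b) else 0)" for b
  have x1: "b \<in> J \<Longrightarrow> x b = t b" for b by (simp add: x_def)
  have x2: "k \<in> Q \<Longrightarrow> x (j k) = w k" for k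
    using assms by (auto simp: x_def the_inv_into_f_f)
  have "finite J" using assms(1) by (rule finite_subset) simp
  moreover have "finite Q" using finite_subset[OF assms(2)] assms(3) finite_imageD by blast
  ultimately
  have "(\<Sum>b<q. x b) = (\<Sum>b\<in>J \<union> j ` Q. x b)"
    by (intro sum.mono_neutral_right) (use assms in \<open>auto simp: x_def\<close>)
  also have "\<dots> = (\<Sum>b\<in>J. x b) + (\<Sum>b\<in>j ` Q. x b)"
    by (intro sum.union_disjoint) (use assms \<open>finite J\<close> \<open>finite Q\<close> in auto)
  also have "(\<Sum>b\<in>j ` Q. x b) = (\<Sum>k\<in>Q. w k)"
    using assms(3) by (simp add: sum.reindex x2)
  finally have s: "(\<Sum>b<q. x b) = (\<Sum>b\<in>J. t b) + (\<Sum>k\<in>Q. w k)" using x1 by simp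
  show ?thesis by (rule that[of x]) (simp_all add: x1 x2 s)
qed

text \<open>
  The positions \<open>(i k, j k)\<close> are edges of a bipartite graph between rows and columns. Condition (C1)
  says that every edge has an end of degree one, so that the components of the graph are stars. Edges
  in \<open>P\<close> have their leaf at the row \<open>i k\<close> and their centre at the column \<open>j k\<close>; edges in \<open>Q\<close> are the
  other way round.
\<close>

definition star_forest :: "nat \<Rightarrow> nat \<Rightarrow> (nat \<Rightarrow> nat) \<Rightarrow> (nat \<Rightarrow> nat) \<Rightarrow> nat set \<Rightarrow> nat set \<Rightarrow> bool" where
  "star_forest n q i j P Q \<longleftrightarrow> finite P \<and> finite Q \<and> P \<inter> Q = {} \<and>
     i ` (P \<union> Q) \<subseteq> {..<n} \<and> j ` (P \<union> Q) \<subseteq> {..<q} \<and>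
     inj_on i P \<and> inj_on j Q \<and> i ` P \<inter> i ` Q = {} \<and> j ` P \<inter> j ` Q = {}"

text \<open>
  On a forest the products \<open>z (i k) * x (j k)\<close> along the edges can be prescribed freely, and the
  nonzero values \<open>t\<close>, \<open>s\<close> at the centres remain at our disposal: the leaves absorb the quotients.
  All vertices off the edges get the value zero, so the two total sums are known.
\<close>

lemma star_forest_values:
  fixes t s u :: "nat \<Rightarrow> 'a::field"
  assumes sf: "star_forest n q i j P Q"
    and nz: "\<And>b. t b \<noteq> 0" "\<And>a. s a \<noteq> 0"
  obtains x z where "\<And>k. k \<in> P \<union> Q \<Longrightarrow> z (i k) * x (j k) = u k"
    "(\<Sum>b<q. x b) = (\<Sum>b\<in>j ` P. t b) + (\<Sum>k\<in>Q. u k / s (i k))"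
    "(\<Sum>a<n. z a) = (\<Sum>a\<in>i ` Q. s a) + (\<Sum>k\<in>P. u k / t (j k))"
proof -
  obtain x where x: "\<And>b. b \<in> j ` P \<Longrightarrow> x b = t b" "\<And>k. k \<in> Q \<Longrightarrow> x (j k) = u k / s (i k)"
    "(\<Sum>b<q. x b) = (\<Sum>b\<in>j ` P. t b) + (\<Sum>k\<in>Q. u k / s (i k))"
    by (rule prescribed_sum[of "j ` P" q j Q t "\<lambda>k. u k / s (i k)"])
      (use sf in \<open>auto simp: star_forest_def\<close>)
  obtain z where z: "\<And>a. a \<in> i ` Q \<Longrightarrow> z a = s a" "\<And>k. k \<in> P \<Longrightarrow> z (i k) = u k / t (j k)"
    "(\<Sum>a<n. z a) = (\<Sum>a\<in>i ` Q. s a) + (\<Sum>k\<in>P. u k / t (j k))"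
    by (rule prescribed_sum[of "i ` Q" n i P s "\<lambda>k. u k / t (j k)"])
      (use sf in \<open>auto simp: star_forest_def\<close>)
  show ?thesis
    by (rule that[OF _ x(3) z(3)]) (use x z nz in auto)
qed

text \<open>
  The vector \<open>v\<close> arises from the product vector of \<open>z\<close> and \<open>x\<close>: the entry at the position \<open>(i k, j k)\<close>
  becomes the coordinate \<open>k\<close>, and every entry elsewhere adds its multiple of \<open>c\<close>. These entries sum to
  \<open>(\<Sum>a<n. z a) * (\<Sum>b<q. x b)\<close> minus the sum over the chosen positions; this number is called \<open>\<sigma>\<close>
  in the proofs below.
\<close>

definition reachable ::
  "nat \<Rightarrow> nat \<Rightarrow> (nat \<Rightarrow> nat) \<Rightarrow> (nat \<Rightarrow> nat) \<Rightarrow> nat set \<Rightarrow> (nat \<Rightarrow> 'a) \<Rightarrow> (nat \<Rightarrow> 'a::field) \<Rightarrow> bool" where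
  "reachable n q i j K c v \<longleftrightarrow> (\<exists>x z. \<forall>k\<in>K.
     v k = z (i k) * x (j k)
       + c k * ((\<Sum>a<n. z a) * (\<Sum>b<q. x b) - (\<Sum>l\<in>K. z (i l) * x (j l))))"

lemma reachable_swap: "reachable n q i j K c v \<Longrightarrow> reachable q n j i K c v"
  unfolding reachable_def by (metis (no_types, lifting) mult.commute sum.cong)

lemma star_forest_swap: "star_forest n q i j P Q \<Longrightarrow> star_forest q n j i Q P"
  by (auto simp: star_forest_def)

text \<open>
  Every centre at a column gets the value \<open>r\<close>, every centre at a row the value 1. If \<open>\<sigma>\<close> is the
  sum over the positions that were not chosen, the products along the edges must be
  \<open>v k - c k * \<sigma>\<close>, and consistency of \<open>\<sigma>\<close> is exactly the balance equation.
\<close>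

lemma reachable_mixed:
  fixes c v :: "nat \<Rightarrow> 'a::form_field"
  assumes sf: "star_forest n q i j P Q" and ne: "P \<noteq> {}" "Q \<noteq> {}"
    and v: "(\<Sum>k\<in>P. v k) \<noteq> 0" "(\<Sum>k\<in>Q. v k) \<noteq> 0"
  shows "reachable n q i j (P \<union> Q) c v"
proof -
  define A B a b where "A = (\<Sum>k\<in>P. v k)" and "B = (\<Sum>k\<in>Q. v k)"
    and "a = (\<Sum>k\<in>P. c k)" and "b = (\<Sum>k\<in>Q. c k)"
  have fin: "finite P" "finite Q" "P \<inter> Q = {}" using sf by (auto simp: star_forest_def)
  have "0 < card (j ` P)" "0 < card (i ` Q)" using fin ne by (auto simp: card_gt_0_iff)
  from balance_solvable[OF v this, folded A_def B_def, of b a] obtain \<sigma> r where r: "r \<noteq> 0"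
    and \<sigma>: "\<sigma> = (of_nat (card (j ` P)) * r + (B - b * \<sigma>)) * (of_nat (card (i ` Q)) + (A - a * \<sigma>) / r)
      - (A - a * \<sigma>) - (B - b * \<sigma>)" by blast
  define u where "u k = v k - c k * \<sigma>" for k
  have uP: "(\<Sum>k\<in>P. u k) = A - a * \<sigma>" and uQ: "(\<Sum>k\<in>Q. u k) = B - b * \<sigma>"
    by (simp_all add: u_def sum_subtractf A_def a_def B_def b_def sum_distrib_right)
  obtain x z where xz: "\<And>k. k \<in> P \<union> Q \<Longrightarrow> z (i k) * x (j k) = u k"
    "(\<Sum>b<q. x b) = (\<Sum>b\<in>j ` P. r) + (\<Sum>k\<in>Q. u k / 1)"
    "(\<Sum>a<n. z a) = (\<Sum>a\<in>i ` Q. 1) + (\<Sum>k\<in>P. u k / r)"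
    by (rule star_forest_values[OF sf, of "\<lambda>_. r" "\<lambda>_. 1" u]) (use r in auto)
  have x: "(\<Sum>b<q. x b) = of_nat (card (j ` P)) * r + (B - b * \<sigma>)"
    using xz(2) uQ by simp
  have z: "(\<Sum>a<n. z a) = of_nat (card (i ` Q)) + (A - a * \<sigma>) / r"
    using xz(3) uP by (simp add: sum_divide_distrib[symmetric])
  have "(\<Sum>l\<in>P \<union> Q. z (i l) * x (j l)) = (\<Sum>l\<in>P \<union> Q. u l)"
    by (rule sum.cong) (use xz in auto)
  also have "\<dots> = (A - a * \<sigma>) + (B - b * \<sigma>)" using fin uP uQ by (simp add: sum.union_disjoint)
  finally have "(\<Sum>a<n. z a) * (\<Sum>b<q. x b) - (\<Sum>l\<in>P \<union> Q. z (i l) * x (j l)) = \<sigma>"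
    unfolding x z by (subst \<sigma>) (simp add: mult.commute diff_diff_eq)
  then show ?thesis unfolding reachable_def
    by (intro exI[of _ x] exI[of _ z]) (use xz(1) in \<open>auto simp: u_def\<close>)
qed

lemma weights_sum_zero:
  assumes "finite I" "2 \<le> card I"
  obtains s :: "'b \<Rightarrow> 'a::field_char_0" where "\<And>a. s a \<noteq> 0" "(\<Sum>a\<in>I. s a) = 0"
proof -
  obtain d where d: "d \<in> I" using assms by fastforce
  define s :: "'b \<Rightarrow> 'a" where "s a = (if a = d then - of_nat (card I - 1) else 1)" for a
  have "(\<Sum>a\<in>I. s a) = s d + (\<Sum>a\<in>I - {d}. s a)" using assms d by (simp add: sum.remove)
  also have "(\<Sum>a\<in>I - {d}. s a) = (\<Sum>a\<in>I - {d}. 1)" by (rule sum.cong) (auto simp: s_def)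
  finally have "(\<Sum>a\<in>I. s a) = 0" using assms d by (simp add: s_def card_Diff_singleton)
  moreover have "s a \<noteq> 0" for a using assms by (simp add: s_def)
  ultimately show ?thesis using that by blast
qed

text \<open>
  If all centres lie on the same side, then for fixed centre values \<open>s\<close> the consistency condition for
  \<open>\<sigma>\<close> is linear. Its coefficient is \<open>1 - b\<close> if the centre values add up to zero, and it is \<open>1 + (p - 1) * b\<close>
  if all \<open>p\<close> of them are one; these two numbers cannot both vanish.
\<close>

lemma reachable_pure:
  fixes c v :: "nat \<Rightarrow> 'a::field_char_0"
  assumes sf: "star_forest n q i j {} Q"
  shows "reachable n q i j Q c v"
proof -
  define B b where "B = (\<Sum>k\<in>Q. v k)" and "b = (\<Sum>k\<in>Q. c k)"
  have fin: "finite Q" using sf by (auto simp: star_forest_def)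
  have "\<exists>s \<sigma>. (\<forall>a. s a \<noteq> 0) \<and>
    \<sigma> = (\<Sum>a\<in>i ` Q. s a) * (\<Sum>k\<in>Q. (v k - c k * \<sigma>) / s (i k)) - (B - b * \<sigma>)"
  proof (cases "b \<noteq> 1 \<and> 2 \<le> card (i ` Q)")
    case True
    then obtain s :: "nat \<Rightarrow> 'a" where s: "\<And>a. s a \<noteq> 0" "(\<Sum>a\<in>i ` Q. s a) = 0"
      using weights_sum_zero[of "i ` Q"] fin by blast
    show ?thesis
      by (rule exI[of _ s], rule exI[of _ "- B / (1 - b)"])
        (use s True in \<open>simp add: field_simps\<close>)
  next
    case False
    define e where "e = 1 + (of_nat (card (i ` Q)) - 1) * b"
    have e: "e \<noteq> 0"
    proof (cases "Q = {}")
      case True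
      then show ?thesis by (simp add: e_def b_def)
    next
      case Q: False
      then have "card (i ` Q) \<noteq> 0" using fin by simp
      then have "b = 1 \<or> card (i ` Q) = 1" using False by linarith
      then show ?thesis using Q fin by (auto simp: e_def)
    qed
    define \<sigma> where "\<sigma> = (of_nat (card (i ` Q)) - 1) * B / e"
    have "\<sigma> * e = (of_nat (card (i ` Q)) - 1) * B" using e by (simp add: \<sigma>_def)
    then have "\<sigma> = of_nat (card (i ` Q)) * (B - b * \<sigma>) - (B - b * \<sigma>)"
      by (simp add: e_def algebra_simps)
    moreover have "(\<Sum>k\<in>Q. (v k - c k * \<sigma>) / 1) = B - b * \<sigma>"
      by (simp add: sum_subtractf B_def b_def sum_distrib_right)
    ultimately show ?thesis by (intro exI[of _ "\<lambda>_. 1"] exI[of _ \<sigma>]) simp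
  qed
  then obtain s \<sigma> where s: "\<And>a. s a \<noteq> 0"
    and \<sigma>: "\<sigma> = (\<Sum>a\<in>i ` Q. s a) * (\<Sum>k\<in>Q. (v k - c k * \<sigma>) / s (i k)) - (B - b * \<sigma>)" by blast
  define u where "u k = v k - c k * \<sigma>" for k
  obtain x z where xz: "\<And>k. k \<in> {} \<union> Q \<Longrightarrow> z (i k) * x (j k) = u k"
    "(\<Sum>b<q. x b) = (\<Sum>b\<in>j ` {}. 1) + (\<Sum>k\<in>Q. u k / s (i k))"
    "(\<Sum>a<n. z a) = (\<Sum>a\<in>i ` Q. s a) + (\<Sum>k\<in>{}. u k / 1)"
    by (rule star_forest_values[OF sf, of "\<lambda>_. 1" s u]) (use s in auto)
  have "(\<Sum>l\<in>Q. z (i l) * x (j l)) = (\<Sum>l\<in>Q. u l)"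
    by (rule sum.cong) (use xz in auto)
  also have "\<dots> = B - b * \<sigma>"
    by (simp add: u_def sum_subtractf B_def b_def sum_distrib_right)
  finally have "(\<Sum>a<n. z a) * (\<Sum>b<q. x b) - (\<Sum>l\<in>Q. z (i l) * x (j l)) = \<sigma>"
    using \<sigma> xz(2,3) by (simp add: u_def)
  then show ?thesis unfolding reachable_def
    by (intro exI[of _ x] exI[of _ z]) (use xz(1) in \<open>auto simp: u_def\<close>)
qed

section \<open>Positive semidefinite forms\<close>

lemma conjugate_one [simp]: "conjugate (1::'a::conjugatable_field) = 1"
proof -
  have "conjugate (1::'a) * conjugate 1 = conjugate 1"
    by (metis conjugate_dist_mul mult_1)
  then show ?thesis by (metis conjugate_zero_iff mult_cancel_right1 zero_neq_one)
qed

lemma conjugate_inverse: "conjugate (inverse x) = inverse (conjugate (x::'a::conjugatable_field))"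
proof (cases "x = 0")
  case False
  then have "conjugate x * conjugate (inverse x) = 1"
    by (simp flip: conjugate_dist_mul)
  then show ?thesis by (metis inverse_unique)
qed simp

lemma conjugate_divide:
  "conjugate (x / y) = conjugate x / conjugate (y::'a::conjugatable_field)"
  by (simp add: divide_inverse conjugate_dist_mul conjugate_inverse)

lemma conjugate_of_nat [simp]: "conjugate (of_nat n :: 'a::conjugatable_field) = of_nat n"
  by (induction n) (simp_all add: conjugate_dist_add)

text \<open>
  Forms are coefficient functions rather than matrices, so that they can be restricted, extended and
  composed without carrier conditions.
\<close>

definition pos_form :: "nat \<Rightarrow> (nat \<Rightarrow> nat \<Rightarrow> 'a::conjugatable_ordered_field) \<Rightarrow> bool" where
  "pos_form d g \<longleftrightarrow> (\<forall>i<d. \<forall>j<d. conjugate (g i j) = g j i) \<and>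
     (\<forall>y. 0 \<le> (\<Sum>i<d. \<Sum>j<d. conjugate (y i) * g i j * y j))"

lemma pos_form_hermitian: "pos_form d g \<Longrightarrow> i < d \<Longrightarrow> j < d \<Longrightarrow> conjugate (g i j) = g j i"
  by (simp add: pos_form_def)

lemma pos_form_nonneg: "pos_form d g \<Longrightarrow> 0 \<le> (\<Sum>i<d. \<Sum>j<d. conjugate (y i) * g i j * y j)"
  by (simp add: pos_form_def)

lemma sum_sandwich:
  fixes v :: "'a::comm_semiring_0"
  shows "(\<Sum>l\<in>A. X l) * v * (\<Sum>k\<in>B. Y k) = (\<Sum>l\<in>A. \<Sum>k\<in>B. X l * v * Y k)"
  by (simp only: sum_distrib_right[of X A v] sum_product)

lemma form_Suc:
  fixes g :: "nat \<Rightarrow> nat \<Rightarrow> 'a::conjugatable_field"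
  shows "(\<Sum>i<Suc d. \<Sum>j<Suc d. conjugate (y i) * g i j * y j) =
    (\<Sum>i<d. \<Sum>j<d. conjugate (y i) * g i j * y j) + (\<Sum>i<d. conjugate (y i) * g i d) * y d
    + conjugate (y d) * (\<Sum>j<d. g d j * y j) + conjugate (y d) * g d d * y d"
  by (simp add: sum.distrib sum_distrib_left sum_distrib_right mult.assoc)

lemma pos_form_diag:
  assumes "pos_form (Suc d) g"
  shows "0 \<le> g d d"
proof -
  define y :: "nat \<Rightarrow> 'a" where "y i = (if i = d then 1 else 0)" for i
  have "(\<Sum>i<Suc d. \<Sum>j<Suc d. conjugate (y i) * g i j * y j) = g d d"
    unfolding form_Suc by (simp add: y_def)
  then show ?thesis using pos_form_nonneg[OF assms, of y] by simp
qed

text \<open>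
  Otherwise a multiple of the last unit vector, added to the unit vector at \<open>k\<close>, makes the form
  negative.
\<close>

lemma pos_form_zero_diag:
  fixes g :: "nat \<Rightarrow> nat \<Rightarrow> 'a::form_field"
  assumes g: "pos_form (Suc d) g" and z: "g d d = 0" and k: "k \<le> d"
  shows "g k d = 0" "g d k = 0"
proof -
  show *: "g k d = 0"
  proof (rule ccontr)
    assume ne: "g k d \<noteq> 0"
    with z k have "k < d" by (metis le_neq_implies_less)
    have c: "conjugate (g k d) = g d k" "conjugate (g k k) = g k k"
      using pos_form_hermitian[OF g] k by auto
    have c2: "conjugate (2::'a) = 2" using conjugate_of_nat[of 2, where 'a='a] by simp
    \<comment> \<open>this choice makes the form equal to \<open>- 1\<close>\<close>
    define t where "t = - (g k k + 1) / (2 * g k d)"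
    define y where "y i = (if i = d then t else if i = k then 1 else 0)" for i
    have y: "y d = t" "i < d \<Longrightarrow> y i = (if i = k then 1 else 0)" for i
      by (auto simp: y_def)
    have y1: "(\<Sum>i<d. conjugate (y i) * h i) = h k" for h
      by (subst sum.remove[of _ k]) (use \<open>k < d\<close> in \<open>auto simp: y(2)\<close>)
    have y2: "(\<Sum>j<d. h j * y j) = h k" for h
      by (subst sum.remove[of _ k]) (use \<open>k < d\<close> in \<open>auto simp: y(2)\<close>)
    have "(\<Sum>i<Suc d. \<Sum>j<Suc d. conjugate (y i) * g i j * y j)
      = g k k + g k d * t + conjugate t * g d k"
      unfolding form_Suc y1 y2 y(1) using y1[of "\<lambda>i. g i k"] z by simp
    also have "g k d * t = - (g k k + 1) / 2" using ne by (simp add: t_def)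
    also have "conjugate t * g d k = conjugate (g k d * t)"
      by (simp add: c conjugate_dist_mul mult.commute)
    also have "g k d * t = - (g k k + 1) / 2" using ne by (simp add: t_def)
    also have "conjugate (- (g k k + 1) / 2) = - (g k k + 1) / 2"
      by (simp only: conjugate_divide conjugate_neg conjugate_dist_add c c2 conjugate_one)
    also have "g k k + - (g k k + 1) / 2 + - (g k k + 1) / 2 = - 1"
      by (simp add: field_simps)
    finally have "(0::'a) \<le> - 1" using pos_form_nonneg[OF g, of y] by simp
    then show False using conjugate_square_positive[of "1::'a"] by simp
  qed
  then show "g d k = 0" using pos_form_hermitian[OF g, of k d] k by auto
qed

text \<open>
  The value of the complement at \<open>y\<close> is the value of \<open>g\<close> at the extension of \<open>y\<close> whose last entry
  minimizes the form. If \<open>g d d = 0\<close>, division by zero makes the subtracted term vanish, so the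
  statement is then about the restriction of \<open>g\<close>.
\<close>

lemma pos_form_Schur_complement:
  fixes g :: "nat \<Rightarrow> nat \<Rightarrow> 'a::form_field"
  assumes g: "pos_form (Suc d) g"
  shows "pos_form d (\<lambda>i j. g i j - g i d * g d j / g d d)"
  unfolding pos_form_def
proof (intro conjI allI impI)
  have h: "i \<le> d \<Longrightarrow> j \<le> d \<Longrightarrow> conjugate (g i j) = g j i" for i j
    using pos_form_hermitian[OF g] by simp
  show "conjugate (g i j - g i d * g d j / g d d) = g j i - g j d * g d i / g d d"
    if "i < d" "j < d" for i j
    using that h
    by (simp add: diff_conv_add_uminus conjugate_dist_add conjugate_neg conjugate_divide
        conjugate_dist_mul mult.commute del: add_uminus_conv_diff)
  fix y :: "nat \<Rightarrow> 'a"
  define R where "R = (\<Sum>j<d. g d j * y j)"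
  have cR: "(\<Sum>i<d. conjugate (y i) * g i d) = conjugate R"
    by (simp add: R_def sum_conjugate conjugate_dist_mul h mult.commute)
  define y' where "y' = y(d := - R / g d d)"
  have "0 \<le> (\<Sum>i<Suc d. \<Sum>j<Suc d. conjugate (y' i) * g i j * y' j)"
    by (rule pos_form_nonneg[OF g])
  also have "\<dots> = (\<Sum>i<d. \<Sum>j<d. conjugate (y i) * g i j * y j) + conjugate R * y' d
    + conjugate (y' d) * R + conjugate (y' d) * g d d * y' d"
    unfolding form_Suc by (simp add: y'_def cR flip: R_def)
  also have "conjugate R * y' d + conjugate (y' d) * R + conjugate (y' d) * g d d * y' d
      = - (conjugate R * R / g d d)"
    by (cases "g d d = 0")
      (simp_all add: y'_def conjugate_divide conjugate_neg h field_simps)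
  then have "(\<Sum>i<d. \<Sum>j<d. conjugate (y i) * g i j * y j) + conjugate R * y' d
    + conjugate (y' d) * R + conjugate (y' d) * g d d * y' d
    = (\<Sum>i<d. \<Sum>j<d. conjugate (y i) * g i j * y j) - conjugate R * R / g d d"
    by (simp add: add.assoc)
  also have "conjugate R * R / g d d
      = (\<Sum>i<d. conjugate (y i) * g i d) * inverse (g d d) * (\<Sum>j<d. g d j * y j)"
    by (simp add: cR R_def divide_inverse mult_ac)
  also have "\<dots> = (\<Sum>i<d. \<Sum>j<d. conjugate (y i) * (g i d * g d j / g d d) * y j)"
    unfolding sum_sandwich by (intro sum.cong refl) (simp add: divide_inverse mult_ac)
  finally show "0 \<le> (\<Sum>i<d. \<Sum>j<d. conjugate (y i) * (g i j - g i d * g d j / g d d) * y j)"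
    by (simp add: sum_subtractf algebra_simps)
qed

text \<open>
  The theorem of Fejer, by elimination: \<open>g\<close> is its Schur complement plus a nonnegative multiple of a
  form of rank one, and for a form of rank one the sum is a value of \<open>h\<close>. This avoids
  diagonalizing \<open>g\<close>.
\<close>

lemma Fejer_sum_nonneg:
  fixes g h :: "nat \<Rightarrow> nat \<Rightarrow> 'a::form_field"
  assumes "pos_form d g" "pos_form d h"
  shows "0 \<le> (\<Sum>i<d. \<Sum>j<d. g i j * h i j)"
  using assms
proof (induction d arbitrary: g)
  case 0
  show ?case by simp
next
  case (Suc d)
  note g = Suc.prems(1) and h = Suc.prems(2)
  have herm: "i \<le> d \<Longrightarrow> j \<le> d \<Longrightarrow> conjugate (g i j) = g j i" for i j
    using pos_form_hermitian[OF g] by simp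
  have hd: "pos_form d h"
    unfolding pos_form_def
  proof (intro conjI allI impI)
    show "conjugate (h i j) = h j i" if "i < d" "j < d" for i j
      using pos_form_hermitian[OF h] that by simp
    fix y :: "nat \<Rightarrow> 'a"
    have "(\<Sum>i<Suc d. \<Sum>j<Suc d. conjugate ((y(d := 0)) i) * h i j * (y(d := 0)) j)
      = (\<Sum>i<d. \<Sum>j<d. conjugate (y i) * h i j * y j)"
      unfolding form_Suc by simp
    then show "0 \<le> (\<Sum>i<d. \<Sum>j<d. conjugate (y i) * h i j * y j)"
      using pos_form_nonneg[OF h, of "y(d := 0)"] by simp
  qed
  define g' where "g' i j = g i j - g i d * g d j / g d d" for i j
  have IH: "0 \<le> (\<Sum>i<d. \<Sum>j<d. g' i j * h i j)"
    unfolding g'_def by (rule Suc.IH[OF pos_form_Schur_complement[OF g] hd])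
  have e: "(\<Sum>i<Suc d. \<Sum>j<Suc d. g' i j * h i j) = (\<Sum>i<d. \<Sum>j<d. g' i j * h i j)"
  proof -
    have z: "g' i d = 0" "g' d i = 0" if "i \<le> d" for i
    proof -
      have "g i d = 0 \<and> g d i = 0 \<or> g d d \<noteq> 0" using pos_form_zero_diag[OF g _ that] by blast
      then show "g' i d = 0" "g' d i = 0" by (auto simp: g'_def)
    qed
    show ?thesis by (simp add: z)
  qed
  have rank_one: "0 \<le> (\<Sum>i<Suc d. \<Sum>j<Suc d. g i d * g d j / g d d * h i j)"
  proof -
    have "0 \<le> inverse (g d d)"
    proof -
      have "0 \<le> g d d * (inverse (g d d) * conjugate (inverse (g d d)))"
        by (intro mult_nonneg_nonneg pos_form_diag[OF g] conjugate_square_positive)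
      then show ?thesis by (cases "g d d = 0") (simp_all add: conjugate_inverse herm mult.assoc[symmetric])
    qed
    moreover have "0 \<le> (\<Sum>i<Suc d. \<Sum>j<Suc d. conjugate (g d i) * h i j * g d j)"
      by (rule pos_form_nonneg[OF h])
    ultimately have "0 \<le> inverse (g d d) * (\<Sum>i<Suc d. \<Sum>j<Suc d. conjugate (g d i) * h i j * g d j)"
      by (rule mult_nonneg_nonneg)
    also have "\<dots> = (\<Sum>i<Suc d. \<Sum>j<Suc d. inverse (g d d) * (conjugate (g d i) * h i j * g d j))"
      by (simp only: sum_distrib_left)
    also have "\<dots> = (\<Sum>i<Suc d. \<Sum>j<Suc d. g i d * g d j / g d d * h i j)"
      by (intro sum.cong refl) (simp add: herm divide_inverse mult_ac)
    finally show ?thesis .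
  qed
  have "0 \<le> (\<Sum>i<Suc d. \<Sum>j<Suc d. g' i j * h i j)
     + (\<Sum>i<Suc d. \<Sum>j<Suc d. g i d * g d j / g d d * h i j)"
    by (rule add_nonneg_nonneg[OF IH[folded e] rank_one])
  also have "\<dots> = (\<Sum>i<Suc d. \<Sum>j<Suc d. g i j * h i j)"
    unfolding sum.distrib[symmetric] g'_def by (intro sum.cong refl) (simp add: algebra_simps)
  finally show ?case .
qed

lemma pos_form_congruence:
  assumes V: "pos_form N V"
  shows "pos_form m (\<lambda>l k. \<Sum>r<N. \<Sum>c<N. conjugate (\<xi> l r) * V r c * \<xi> k c)"
  unfolding pos_form_def
proof (intro conjI allI impI)
  fix l k
  have "conjugate (\<Sum>r<N. \<Sum>c<N. conjugate (\<xi> l r) * V r c * \<xi> k c)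
    = (\<Sum>r<N. \<Sum>c<N. \<xi> l r * V c r * conjugate (\<xi> k c))"
    by (simp add: sum_conjugate conjugate_dist_mul pos_form_hermitian[OF V])
  also have "\<dots> = (\<Sum>c<N. \<Sum>r<N. conjugate (\<xi> k c) * V c r * \<xi> l r)"
    by (subst sum.swap) (simp add: mult_ac)
  finally show "conjugate (\<Sum>r<N. \<Sum>c<N. conjugate (\<xi> l r) * V r c * \<xi> k c)
    = (\<Sum>r<N. \<Sum>c<N. conjugate (\<xi> k r) * V r c * \<xi> l c)" .
next
  fix y
  have "(\<Sum>l<m. \<Sum>k<m. conjugate (y l) * (\<Sum>r<N. \<Sum>c<N. conjugate (\<xi> l r) * V r c * \<xi> k c) * y k)
    = (\<Sum>l<m. \<Sum>k<m. \<Sum>r<N. \<Sum>c<N. conjugate (y l * \<xi> l r) * V r c * (y k * \<xi> k c))"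
    by (simp add: sum_distrib_left sum_distrib_right conjugate_dist_mul mult_ac)
  also have "\<dots> = (\<Sum>l<m. \<Sum>r<N. \<Sum>k<m. \<Sum>c<N. conjugate (y l * \<xi> l r) * V r c * (y k * \<xi> k c))"
    by (intro sum.cong refl sum.swap)
  also have "\<dots> = (\<Sum>r<N. \<Sum>l<m. \<Sum>k<m. \<Sum>c<N. conjugate (y l * \<xi> l r) * V r c * (y k * \<xi> k c))"
    by (rule sum.swap)
  also have "\<dots> = (\<Sum>r<N. \<Sum>l<m. \<Sum>c<N. \<Sum>k<m. conjugate (y l * \<xi> l r) * V r c * (y k * \<xi> k c))"
    by (intro sum.cong refl sum.swap)
  also have "\<dots> = (\<Sum>r<N. \<Sum>c<N. \<Sum>l<m. \<Sum>k<m. conjugate (y l * \<xi> l r) * V r c * (y k * \<xi> k c))"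
    by (intro sum.cong refl sum.swap)
  also have "\<dots> = (\<Sum>r<N. \<Sum>c<N. conjugate (\<Sum>l<m. y l * \<xi> l r) * V r c * (\<Sum>k<m. y k * \<xi> k c))"
    by (simp only: sum_conjugate finite_lessThan sum_sandwich)
  finally show "0 \<le> (\<Sum>l<m. \<Sum>k<m. conjugate (y l) *
      (\<Sum>r<N. \<Sum>c<N. conjugate (\<xi> l r) * V r c * \<xi> k c) * y k)"
    using pos_form_nonneg[OF V, of "\<lambda>r. \<Sum>l<m. y l * \<xi> l r"] by simp
qed

text \<open>
  The mixed case reaches only vectors whose sums over \<open>P\<close> and over \<open>Q\<close> are nonzero. Adding a small
  constant to all entries of \<open>v\<close> makes these sums nonzero, and the limit gives the claim for \<open>v\<close>.
\<close>

lemma nonneg_from_reachable: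
  fixes g :: "nat \<Rightarrow> nat \<Rightarrow> 'a::form_field"
  assumes sf: "star_forest n q i j P Q"
    and pos: "\<And>v. reachable n q i j (P \<union> Q) c v \<Longrightarrow>
      0 \<le> (\<Sum>l\<in>P \<union> Q. \<Sum>k\<in>P \<union> Q. conjugate (v l) * g l k * v k)"
  shows "0 \<le> (\<Sum>l\<in>P \<union> Q. \<Sum>k\<in>P \<union> Q. conjugate (v l) * g l k * v k)"
proof -
  consider "P = {}" | "Q = {}" | "P \<noteq> {}" "Q \<noteq> {}" by blast
  then show ?thesis
  proof cases
    case 1
    then show ?thesis using reachable_pure[of n q i j Q c v] sf pos[of v] by simp
  next
    case 2
    then show ?thesis
      using reachable_swap[OF reachable_pure[of q n j i P c v]] star_forest_swap[OF sf] pos[of v]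
      by simp
  next
    case 3
    define e :: "nat \<Rightarrow> 'a" where "e N = 1 / of_nat N" for N
    have e: "e \<longlonglongrightarrow> 0" unfolding e_def by (rule lim_1_over_n)
    have generic: "\<forall>\<^sub>F N in sequentially. (\<Sum>k\<in>S. v k + e N) \<noteq> 0"
      if S: "finite S" "S \<noteq> {}" for S
    proof (cases "(\<Sum>k\<in>S. v k) = 0")
      case True
      show ?thesis
        using eventually_gt_at_top[of 0]
        by eventually_elim (use True S in \<open>simp add: sum.distrib e_def\<close>)
    next
      case False
      have "(\<lambda>N. \<Sum>k\<in>S. v k + e N) \<longlonglongrightarrow> (\<Sum>k\<in>S. v k + 0)"
        by (intro tendsto_intros e)
      then show ?thesis using tendsto_imp_eventually_ne[of _ "\<Sum>k\<in>S. v k + 0" _ 0] False by simp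
    qed
    have fin: "finite P" "finite Q" using sf by (auto simp: star_forest_def)
    have "\<forall>\<^sub>F N in sequentially.
        0 \<le> (\<Sum>l\<in>P \<union> Q. \<Sum>k\<in>P \<union> Q. (conjugate (v l) + e N) * g l k * (v k + e N))"
      using generic[OF fin(1) 3(1)] generic[OF fin(2) 3(2)]
    proof eventually_elim
      case (elim N)
      have "reachable n q i j (P \<union> Q) c (\<lambda>k. v k + e N)"
        using elim by (intro reachable_mixed[OF sf 3]) auto
      from pos[OF this] show ?case
        by (simp add: conjugate_dist_add e_def conjugate_divide)
    qed
    moreover have "(\<lambda>N. \<Sum>l\<in>P \<union> Q. \<Sum>k\<in>P \<union> Q. (conjugate (v l) + e N) * g l k * (v k + e N))
      \<longlonglongrightarrow> (\<Sum>l\<in>P \<union> Q. \<Sum>k\<in>P \<union> Q. (conjugate (v l) + 0) * g l k * (v k + 0))"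
      by (intro tendsto_intros e)
    ultimately show ?thesis
      using Lim_in_closed_set[OF closed_nonneg, of _ sequentially] by fastforce
  qed
qed

text \<open>
  The edges with a unique column go to \<open>Q\<close>, including isolated edges; all others have a unique row.
\<close>

lemma star_forest_if_cond_C1:
  assumes C1: "cond_C1 m i j" and bd: "\<forall>k<m. i k < n \<and> j k < q"
  obtains P Q where "star_forest n q i j P Q" "P \<union> Q = {..<m}"
proof
  define Q where "Q = {k. k < m \<and> (\<forall>l<m. l \<noteq> k \<longrightarrow> j l \<noteq> j k)}"
  have i: "i l \<noteq> i k" if "k < m" "k \<notin> Q" "l < m" "l \<noteq> k" for k l
    using C1 that unfolding cond_C1_def Q_def by blast
  have j: "j l \<noteq> j k" if "k \<in> Q" "l < m" "l \<noteq> k" for k l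
    using that unfolding Q_def by blast
  show "star_forest n q i j ({..<m} - Q) Q"
    unfolding star_forest_def
  proof (intro conjI)
    show "inj_on i ({..<m} - Q)" by (rule inj_onI) (metis DiffE i lessThan_iff)
    show "inj_on j Q" by (rule inj_onI) (use j Q_def in blast)
    show "i ` ({..<m} - Q) \<inter> i ` Q = {}" using i unfolding Q_def by fastforce
    show "j ` ({..<m} - Q) \<inter> j ` Q = {}" using j by fastforce
  qed (use bd in \<open>auto simp: Q_def\<close>)
  show "({..<m} - Q) \<union> Q = {..<m}" by (auto simp: Q_def)
qed

section \<open>Matrices in coordinates\<close>

lemma mat_adjoint_index:
  assumes "A \<in> carrier_mat d e" "i < e" "k < d"
  shows "mat_adjoint A $$ (i, k) = conjugate (A $$ (k, i))"
  using assms unfolding mat_adjoint_def by (simp add: mat_of_rows_index)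

lemma mat_adjoint_carrier: "A \<in> carrier_mat d e \<Longrightarrow> mat_adjoint A \<in> carrier_mat e d"
  unfolding mat_adjoint_def by auto

lemma quadratic_form_expand:
  fixes A :: "'a::conjugatable_field mat"
  assumes "A \<in> carrier_mat d d"
  shows "(A *\<^sub>v vec d y) \<bullet>c vec d y = (\<Sum>i<d. \<Sum>k<d. conjugate (y i) * A $$ (i, k) * y k)"
  using assms
  by (simp add: scalar_prod_def atLeast0LessThan sum_distrib_left sum_distrib_right mult_ac)

lemma psd_iff_pos_form:
  "psd d A \<longleftrightarrow> A \<in> carrier_mat d d \<and> pos_form d (\<lambda>i k. A $$ (i, k))"
proof (cases "A \<in> carrier_mat d d")
  case A: True
  have "mat_adjoint A = A \<longleftrightarrow> (\<forall>i<d. \<forall>k<d. conjugate (A $$ (i, k)) = A $$ (k, i))"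
  proof
    assume "mat_adjoint A = A"
    then show "\<forall>i<d. \<forall>k<d. conjugate (A $$ (i, k)) = A $$ (k, i)"
      using mat_adjoint_index[OF A] by metis
  next
    assume h: "\<forall>i<d. \<forall>k<d. conjugate (A $$ (i, k)) = A $$ (k, i)"
    show "mat_adjoint A = A"
      by (rule eq_matI) (use A mat_adjoint_carrier[OF A] h in \<open>auto simp: mat_adjoint_index[OF A]\<close>)
  qed
  moreover have "(\<forall>x \<in> carrier_vec d. 0 \<le> (A *\<^sub>v x) \<bullet>c x) \<longleftrightarrow>
      (\<forall>y. 0 \<le> (\<Sum>i<d. \<Sum>k<d. conjugate (y i) * A $$ (i, k) * y k))"
  proof
    assume "\<forall>x \<in> carrier_vec d. 0 \<le> (A *\<^sub>v x) \<bullet>c x"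
    then show "\<forall>y. 0 \<le> (\<Sum>i<d. \<Sum>k<d. conjugate (y i) * A $$ (i, k) * y k)"
      using quadratic_form_expand[OF A] by (metis vec_carrier)
  next
    assume h: "\<forall>y. 0 \<le> (\<Sum>i<d. \<Sum>k<d. conjugate (y i) * A $$ (i, k) * y k)"
    show "\<forall>x \<in> carrier_vec d. 0 \<le> (A *\<^sub>v x) \<bullet>c x"
    proof
      fix x :: "'a vec"
      assume "x \<in> carrier_vec d"
      then have "x = vec d (\<lambda>i. x $ i)" by auto
      then show "0 \<le> (A *\<^sub>v x) \<bullet>c x"
        using quadratic_form_expand[OF A] h by metis
    qed
  qed
  ultimately show ?thesis using A by (simp add: psd_def pos_form_def)
qed (simp add: psd_def)

lemma sum_div_mod:
  fixes f :: "nat \<Rightarrow> 'a::comm_monoid_add"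
  shows "(\<Sum>r<k * n. f r) = (\<Sum>\<alpha><k. \<Sum>a<n. f (\<alpha> * n + a))"
proof -
  have "(\<Sum>r<k * n. f r) = (\<Sum>\<alpha><k. \<Sum>r\<in>{\<alpha> * n..<\<alpha> * n + n}. f r)"
    by (rule sum.nat_group[symmetric])
  also have "\<dots> = (\<Sum>\<alpha><k. \<Sum>a<n. f (\<alpha> * n + a))"
  proof (rule sum.cong[OF refl])
    fix \<alpha>
    show "(\<Sum>r\<in>{\<alpha> * n..<\<alpha> * n + n}. f r) = (\<Sum>a<n. f (\<alpha> * n + a))"
      using sum.shift_bounds_nat_ivl[of f 0 "\<alpha> * n" n]
      by (simp add: atLeast0LessThan add.commute)
  qed
  finally show ?thesis .
qed

lemma block_index_less: "i < m \<Longrightarrow> a < n \<Longrightarrow> i * n + a < m * (n::nat)"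
  by (metis add_strict_left_mono less_le_trans mult_Suc mult_le_mono1 Suc_leI add.commute)

lemma sum_reorder6:
  fixes F :: "nat \<Rightarrow> nat \<Rightarrow> nat \<Rightarrow> nat \<Rightarrow> nat \<Rightarrow> nat \<Rightarrow> 'a::comm_monoid_add"
  shows "(\<Sum>a\<in>A. \<Sum>i\<in>I. \<Sum>j\<in>J. \<Sum>b\<in>B. \<Sum>l\<in>M. \<Sum>k\<in>N. F a i j b l k) =
    (\<Sum>l\<in>M. \<Sum>k\<in>N. \<Sum>b\<in>B. \<Sum>j\<in>J. \<Sum>a\<in>A. \<Sum>i\<in>I. F a i j b l k)"
  unfolding sum.cartesian_product
  by (rule sum.reindex_bij_witness[where i="\<lambda>(l, k, b, j, a, i). (a, i, j, b, l, k)"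
        and j="\<lambda>(a, i, j, b, l, k). (l, k, b, j, a, i)"]) auto

text \<open>
  A map whose Choi matrix has the form \<open>T\<^sup>* g T\<close> turns forms into sums of the kind treated by
  \<open>Fejer_sum_nonneg\<close>. Here \<open>K i a j b\<close> is the entry \<open>(a, b)\<close> of the block \<open>(i, j)\<close> of the matricization.
\<close>

lemma form_of_factored_map:
  fixes K :: "nat \<Rightarrow> nat \<Rightarrow> nat \<Rightarrow> nat \<Rightarrow> 'a::conjugatable_field" and m :: nat
  assumes K: "\<And>i a j b. i < n \<Longrightarrow> a < n \<Longrightarrow> j < q \<Longrightarrow> b < q \<Longrightarrow>
    K i a j b = (\<Sum>l<m. \<Sum>k<m. conjugate (T l a b) * g l k * T k i j)"
  shows "(\<Sum>a<n. \<Sum>i<n. conjugate (z a) * (\<Sum>j<q. \<Sum>b<q. K i a j b * V b j) * w i)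
    = (\<Sum>l<m. \<Sum>k<m. g l k * (\<Sum>b<q. \<Sum>j<q.
        conjugate (\<Sum>a<n. z a * T l a b) * V b j * (\<Sum>i<n. w i * T k i j)))"
proof -
  have "(\<Sum>a<n. \<Sum>i<n. conjugate (z a) * (\<Sum>j<q. \<Sum>b<q. K i a j b * V b j) * w i)
    = (\<Sum>a<n. \<Sum>i<n. \<Sum>j<q. \<Sum>b<q. \<Sum>l<m. \<Sum>k<m.
        g l k * (conjugate (z a * T l a b) * V b j * (w i * T k i j)))"
  proof (intro sum.cong refl)
    fix a i assume "a \<in> {..<n}" "i \<in> {..<n}"
    have "(\<Sum>j<q. \<Sum>b<q. K i a j b * V b j) = (\<Sum>j<q. \<Sum>b<q.
        (\<Sum>l<m. \<Sum>k<m. conjugate (T l a b) * g l k * T k i j) * V b j)"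
      by (intro sum.cong refl) (use \<open>a \<in> _\<close> \<open>i \<in> _\<close> K in auto)
    then show "conjugate (z a) * (\<Sum>j<q. \<Sum>b<q. K i a j b * V b j) * w i
      = (\<Sum>j<q. \<Sum>b<q. \<Sum>l<m. \<Sum>k<m.
        g l k * (conjugate (z a * T l a b) * V b j * (w i * T k i j)))"
      by (simp only: sum_distrib_left sum_distrib_right conjugate_dist_mul mult_ac)
  qed
  also have "\<dots> = (\<Sum>l<m. \<Sum>k<m. \<Sum>b<q. \<Sum>j<q. \<Sum>a<n. \<Sum>i<n.
        g l k * (conjugate (z a * T l a b) * V b j * (w i * T k i j)))"
    by (rule sum_reorder6)
  also have "\<dots> = (\<Sum>l<m. \<Sum>k<m. g l k * (\<Sum>b<q. \<Sum>j<q.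
        conjugate (\<Sum>a<n. z a * T l a b) * V b j * (\<Sum>i<n. w i * T k i j)))"
    by (simp only: sum_conjugate finite_lessThan sum_sandwich)
      (simp only: sum_distrib_left)
  finally show ?thesis .
qed

lemma span_image_coeffs:
  fixes B :: "nat \<Rightarrow> 'a::field mat"
  assumes L0: "L0 \<in> mat_span nr nc (B ` {..<m})" and inj: "inj_on B {..<m}"
    and B: "\<And>k. k < m \<Longrightarrow> B k \<in> carrier_mat nr nc"
  obtains c where "\<And>a b. a < nr \<Longrightarrow> b < nc \<Longrightarrow> L0 $$ (a, b) = (\<Sum>k<m. c k * B k $$ (a, b))"
proof -
  interpret vs: vectorspace class_ring "module_mat TYPE('a) nr nc" by (rule matrix_vs)
  from L0 obtain c0 A where A: "finite A" "A \<subseteq> B ` {..<m}" "L0 = vs.lincomb c0 A"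
    unfolding mat_span_def vs.span_def by blast
  have Ac: "A \<subseteq> carrier_mat nr nc" using A(2) B by auto
  have "vs.lincomb c0 A \<in> carrier_mat nr nc \<and>
      (\<forall>a<nr. \<forall>b<nc. vs.lincomb c0 A $$ (a, b) = (\<Sum>M\<in>A. c0 M * M $$ (a, b)))"
    using A(1) Ac
  proof (induction A)
    case empty
    show ?case by (simp add: vs.lincomb_def module_mat_simps)
  next
    case (insert M A)
    have "vs.lincomb c0 (insert M A) = c0 M \<cdot>\<^sub>m M + vs.lincomb c0 A"
      using insert.prems insert.hyps
      by (subst vs.lincomb_insert2) (auto simp: module_mat_simps class_ring_simps)
    then show ?case using insert by auto
  qed
  then have e: "L0 $$ (a, b) = (\<Sum>M\<in>A. c0 M * M $$ (a, b))" if "a < nr" "b < nc" for a b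
    using that A(3) by simp
  show ?thesis
  proof
    fix a b assume ab: "a < nr" "b < nc"
    define S where "S = {k. k < m \<and> B k \<in> A}"
    have "A = B ` S" using A(2) by (auto simp: S_def)
    moreover have "inj_on B S" using inj by (rule inj_on_subset) (auto simp: S_def)
    ultimately have "L0 $$ (a, b) = (\<Sum>k\<in>S. c0 (B k) * B k $$ (a, b))"
      using e[OF ab] by (simp add: sum.reindex)
    also have "\<dots> = (\<Sum>k<m. (if B k \<in> A then c0 (B k) else 0) * B k $$ (a, b))"
      by (rule sum.mono_neutral_cong_left) (auto simp: S_def)
    finally show "L0 $$ (a, b) = (\<Sum>k<m. (if B k \<in> A then c0 (B k) else 0) * B k $$ (a, b))" .
  qed
qed

text \<open>
  With columns stacked, the block \<open>(i, j)\<close> of the matricization maps column \<open>j\<close> of \<open>V\<close> to its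
  contribution to column \<open>i\<close> of the image.
\<close>

lemma matricization_action:
  assumes L: "is_matricization q n \<L> L" and V: "V \<in> carrier_mat q q"
    and LV: "\<L> V \<in> carrier_mat n n" and ai: "a < n" "i < n"
  shows "\<L> V $$ (a, i) = (\<Sum>j<q. \<Sum>b<q. L $$ (i * n + a, j * q + b) * V $$ (b, j))"
proof -
  have Lc: "L \<in> carrier_mat (n * n) (q * q)" and Lv: "L *\<^sub>v stack_cols V = stack_cols (\<L> V)"
    using L V by (auto simp: is_matricization_def power2_eq_square)
  have p: "i * n + a < n * n" by (rule block_index_less) (use ai in auto)
  have "\<L> V $$ (a, i) = stack_cols (\<L> V) $ (i * n + a)"
    using LV ai p by (simp add: stack_cols_def)
  also have "\<dots> = (\<Sum>r<q * q. L $$ (i * n + a, r) * V $$ (r mod q, r div q))"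
    unfolding Lv[symmetric] using Lc V p
    by (simp add: stack_cols_def scalar_prod_def atLeast0LessThan)
  also have "\<dots> = (\<Sum>j<q. \<Sum>b<q. L $$ (i * n + a, j * q + b) * V $$ (b, j))"
    unfolding sum_div_mod by (intro sum.cong refl) simp
  finally show ?thesis .
qed

lemma star_linear_carrier:
  assumes "star_linear q n \<L>" "V \<in> carrier_mat q q"
  shows "\<L> V \<in> carrier_mat n n"
  using assms
  by (auto simp: star_linear_def linear_map_def mod_hom_def mod_hom_axioms_def
      LinearCombinations.module_hom_def module_mat_simps Pi_iff)

text \<open>
  Both sides are entries of images of matrix units that are adjoint to each other. In other words, the
  Choi matrix is Hermitian, where the entries of one of its columns are those of one block.
\<close>

lemma matricization_hermitian:
  fixes \<L> :: "'a::conjugatable_field mat \<Rightarrow> 'a mat"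
  assumes st: "star_linear q n \<L>" and L: "is_matricization q n \<L> L"
    and bd: "a < n" "i < n" "b < q" "j < q"
  shows "conjugate (L $$ (i * n + a, j * q + b)) = L $$ (a * n + i, b * q + j)"
proof -
  have unit: "\<L> (matrix_unit q b j) $$ (a, i) = L $$ (i * n + a, j * q + b)"
    if bd: "a < n" "i < n" "b < q" "j < q" for a i b j
  proof -
    have E: "matrix_unit q b j \<in> carrier_mat q q" by (simp add: matrix_unit_def)
    have "\<L> (matrix_unit q b j) $$ (a, i)
      = (\<Sum>j'<q. \<Sum>b'<q. if b' = b then (if j' = j then L $$ (i * n + a, j' * q + b) else 0) else 0)"
      unfolding matricization_action[OF L E star_linear_carrier[OF st E] bd(1,2)]
      by (intro sum.cong refl) (simp add: matrix_unit_def)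
    then show ?thesis using bd by (simp add: sum.delta)
  qed
  have E: "matrix_unit q b j \<in> carrier_mat q q" by (simp add: matrix_unit_def)
  have "mat_adjoint (matrix_unit q b j) = (matrix_unit q j b :: 'a mat)"
  proof (rule eq_matI)
    fix i' k' assume "i' < dim_row (matrix_unit q j b :: 'a mat)" "k' < dim_col (matrix_unit q j b :: 'a mat)"
    then have bd': "i' < q" "k' < q" by (simp_all add: matrix_unit_def)
    show "mat_adjoint (matrix_unit q b j) $$ (i', k') = (matrix_unit q j b :: 'a mat) $$ (i', k')"
      unfolding mat_adjoint_index[OF E bd'] using bd' by (auto simp: matrix_unit_def)
  qed (use mat_adjoint_carrier[OF E] in \<open>auto simp: matrix_unit_def\<close>)
  moreover have "\<L> (mat_adjoint (matrix_unit q b j)) = mat_adjoint (\<L> (matrix_unit q b j))"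
    using st E unfolding star_linear_def by blast
  ultimately have "\<L> (matrix_unit q j b) = mat_adjoint (\<L> (matrix_unit q b j))" by simp
  then have "\<L> (matrix_unit q j b) $$ (i, a) = conjugate (\<L> (matrix_unit q b j) $$ (a, i))"
    using mat_adjoint_index[OF star_linear_carrier[OF st E], of i a] bd by simp
  then show ?thesis using unit bd by simp
qed

section \<open>Factorization through the chosen blocks\<close>

text \<open>
  The coefficient of the chosen block \<open>k\<close> in the block \<open>(a, b)\<close>. The sum detects the chosen positions,
  because these are distinct; writing it in this way makes sums against product vectors easy.
\<close>

definition coeff_matrix ::
  "nat \<Rightarrow> (nat \<Rightarrow> nat) \<Rightarrow> (nat \<Rightarrow> nat) \<Rightarrow> (nat \<Rightarrow> 'a) \<Rightarrow> nat \<Rightarrow> nat \<Rightarrow> nat \<Rightarrow> 'a::comm_ring_1" where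
  "coeff_matrix m i j c k a b = of_bool ((a, b) = (i k, j k)) +
     c k * (1 - (\<Sum>l<m. of_bool ((a, b) = (i l, j l))))"

lemma coeff_matrix_chosen:
  assumes inj: "inj_on (\<lambda>k. (i k, j k)) {..<m}" and k: "k < m" "l < m"
  shows "coeff_matrix m i j c k (i l) (j l) = of_bool (k = l)"
proof -
  have "(\<Sum>l'<m. of_bool ((i l, j l) = (i l', j l')) :: 'a) = (\<Sum>l'<m. of_bool (l = l'))"
    using inj k by (intro sum.cong refl) (auto simp: inj_on_def)
  also have "\<dots> = 1" using k by (simp add: of_bool_def)
  finally show ?thesis using inj k by (auto simp: coeff_matrix_def inj_on_def)
qed

lemma coeff_matrix_other:
  assumes "\<forall>k<m. (a, b) \<noteq> (i k, j k)" "k < m"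
  shows "coeff_matrix m i j c k a b = c k"
proof -
  have "(\<Sum>l<m. of_bool ((a, b) = (i l, j l)) :: 'a) = 0"
    by (rule sum.neutral) (use assms in auto)
  then show ?thesis using assms by (auto simp: coeff_matrix_def)
qed

lemma sum_pair_of_bool:
  fixes x z :: "nat \<Rightarrow> 'a::comm_ring_1"
  assumes "i0 < n" "j0 < q"
  shows "(\<Sum>a<n. \<Sum>b<q. z a * of_bool ((a, b) = (i0, j0)) * x b) = z i0 * x j0"
proof -
  have inner: "(\<Sum>b<q. z a * of_bool ((a, b) = (i0, j0)) * x b) = (if a = i0 then z a * x j0 else 0)"
    for a
  proof -
    have "(\<Sum>b<q. z a * of_bool ((a, b) = (i0, j0)) * x b)
      = (\<Sum>b<q. if b = j0 then (if a = i0 then z a * x b else 0) else 0)"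
      by (rule sum.cong) auto
    also have "\<dots> = (if a = i0 then z a * x j0 else 0)" using assms(2) by simp
    finally show ?thesis .
  qed
  show ?thesis unfolding inner using assms(1) by simp
qed

lemma coeff_matrix_product_vector:
  fixes x z c :: "nat \<Rightarrow> 'a::comm_ring_1"
  assumes bd: "\<forall>k<m. i k < n \<and> j k < q" and k: "k < m"
  shows "(\<Sum>a<n. \<Sum>b<q. z a * coeff_matrix m i j c k a b * x b) =
    z (i k) * x (j k) + c k * ((\<Sum>a<n. z a) * (\<Sum>b<q. x b) - (\<Sum>l<m. z (i l) * x (j l)))"
proof -
  define \<delta> :: "nat \<Rightarrow> nat \<Rightarrow> nat \<Rightarrow> 'a" where "\<delta> l a b = of_bool ((a, b) = (i l, j l))" for l a b
  have T: "coeff_matrix m i j c k a b = \<delta> k a b + c k * (1 - (\<Sum>l<m. \<delta> l a b))" for a b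
    by (simp only: coeff_matrix_def \<delta>_def)
  have \<delta>: "(\<Sum>a<n. \<Sum>b<q. z a * \<delta> l a b * x b) = z (i l) * x (j l)" if "l < m" for l
    unfolding \<delta>_def by (rule sum_pair_of_bool) (use bd that in auto)
  have "(\<Sum>a<n. \<Sum>b<q. z a * coeff_matrix m i j c k a b * x b) =
     (\<Sum>a<n. \<Sum>b<q. z a * \<delta> k a b * x b
       + (c k * (z a * x b) - (\<Sum>l<m. c k * (z a * \<delta> l a b * x b))))"
    by (intro sum.cong refl)
      (simp add: T algebra_simps sum_distrib_left sum_distrib_right)
  also have "\<dots> = z (i k) * x (j k) + ((\<Sum>a<n. \<Sum>b<q. c k * (z a * x b))
      - (\<Sum>a<n. \<Sum>b<q. \<Sum>l<m. c k * (z a * \<delta> l a b * x b)))"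
    using bd k by (simp only: sum.distrib sum_subtractf \<delta>)
  also have "(\<Sum>a<n. \<Sum>b<q. c k * (z a * x b)) = c k * ((\<Sum>a<n. z a) * (\<Sum>b<q. x b))"
    by (simp only: sum_product) (simp only: sum_distrib_left)
  also have "(\<Sum>a<n. \<Sum>b<q. \<Sum>l<m. c k * (z a * \<delta> l a b * x b))
    = (\<Sum>a<n. \<Sum>l<m. \<Sum>b<q. c k * (z a * \<delta> l a b * x b))"
    by (intro sum.cong refl sum.swap)
  also have "\<dots> = (\<Sum>l<m. \<Sum>a<n. \<Sum>b<q. c k * (z a * \<delta> l a b * x b))"
    by (rule sum.swap)
  also have "\<dots> = (\<Sum>l<m. c k * (z (i l) * x (j l)))"
    by (intro sum.cong refl)
      (use bd in \<open>simp only: sum_distrib_left[symmetric] \<delta> lessThan_iff\<close>)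
  finally show ?thesis by (simp add: sum_distrib_left algebra_simps)
qed

section \<open>Positivity and complete positivity\<close>

lemma positive_if_completely_positive:
  fixes \<L> :: "'a::conjugatable_ordered_field mat \<Rightarrow> 'a mat"
  assumes cp: "completely_positive q n \<L>" and car: "\<And>V. V \<in> carrier_mat q q \<Longrightarrow> \<L> V \<in> carrier_mat n n"
  shows "positive_map q n \<L>"
  unfolding positive_map_def
proof (intro allI impI)
  fix V :: "'a mat" assume V: "psd q V"
  then have Vc: "V \<in> carrier_mat q q" by (simp add: psd_def)
  have "psd (1 * n) (of_blocks 1 n (\<lambda>a b. \<L> (block q q V a b)))"
    using cp V unfolding completely_positive_def positive_map_def by (metis le_refl mult_1)
  moreover have "of_blocks 1 n (\<lambda>a b. \<L> (block q q V a b)) = \<L> V"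
  proof -
    have "block q q V 0 0 = V" by (rule eq_matI) (use Vc in \<open>auto simp: block_def\<close>)
    then show ?thesis by (intro eq_matI) (use car[OF Vc] in \<open>auto simp: of_blocks_def\<close>)
  qed
  ultimately show "psd n (\<L> V)" by simp
qed

text \<open>
  The form of the image at \<open>w\<close> is \<open>(\<Sum>l<m. \<Sum>k<m. g l k * h l k)\<close>, where \<open>h\<close> is the form of the argument
  evaluated at the vectors \<open>\<xi> l\<close> and hence positive semidefinite.
\<close>

lemma completely_positive_if_factored:
  fixes \<L> :: "'a::form_field mat \<Rightarrow> 'a mat" and m :: nat
  assumes act: "\<And>V a i. V \<in> carrier_mat q q \<Longrightarrow> a < n \<Longrightarrow> i < n \<Longrightarrow>
      \<L> V $$ (a, i) = (\<Sum>j<q. \<Sum>b<q. K i a j b * V $$ (b, j))"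
    and herm: "\<And>i a j b. i < n \<Longrightarrow> a < n \<Longrightarrow> j < q \<Longrightarrow> b < q \<Longrightarrow> conjugate (K i a j b) = K a i b j"
    and K: "\<And>i a j b. i < n \<Longrightarrow> a < n \<Longrightarrow> j < q \<Longrightarrow> b < q \<Longrightarrow>
      K i a j b = (\<Sum>l<m. \<Sum>k<m. conjugate (T l a b) * g l k * T k i j)"
    and g: "pos_form m g"
  shows "completely_positive q n \<L>"
  unfolding completely_positive_def positive_map_def
proof (intro allI impI)
  fix p and V :: "'a mat" assume "psd (p * q) V"
  then have Vc: "V \<in> carrier_mat (p * q) (p * q)" and V: "pos_form (p * q) (\<lambda>r s. V $$ (r, s))"
    by (simp_all add: psd_iff_pos_form)
  define M where "M = of_blocks p n (\<lambda>a b. \<L> (block q q V a b))"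
  have M: "M $$ (r, s) = (\<Sum>j<q. \<Sum>b<q. K (s mod n) (r mod n) j b *
      V $$ (r div n * q + b, s div n * q + j))" if "r < p * n" "s < p * n" for r s
  proof -
    have "0 < n" using that by (metis mult_0_right neq0_conv not_less_zero)
    have "block q q V (r div n) (s div n) \<in> carrier_mat q q" by (simp add: block_def)
    from act[OF this] \<open>0 < n\<close> that show ?thesis
      by (simp add: M_def of_blocks_def) (simp add: block_def)
  qed
  have div_bd: "r div n * q + b < p * q" if "r < p * n" "b < q" for r b
    using that by (intro block_index_less) (simp_all add: less_mult_imp_div_less)
  have "pos_form (p * n) (\<lambda>r s. M $$ (r, s))"
    unfolding pos_form_def
  proof (intro conjI allI impI)
    fix r s assume rs: "r < p * n" "s < p * n"
    then have "0 < n" by (metis mult_0_right neq0_conv not_less_zero)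
    have "conjugate (M $$ (r, s)) = (\<Sum>j<q. \<Sum>b<q. K (r mod n) (s mod n) b j *
      V $$ (s div n * q + j, r div n * q + b))"
      unfolding M[OF rs] using rs \<open>0 < n\<close>
      by (simp add: sum_conjugate conjugate_dist_mul herm pos_form_hermitian[OF V] div_bd)
    also have "\<dots> = M $$ (s, r)"
      unfolding M[OF rs(2,1)] by (rule sum.swap)
    finally show "conjugate (M $$ (r, s)) = M $$ (s, r)" .
  next
    fix w :: "nat \<Rightarrow> 'a"
    define \<xi> where "\<xi> l r = (\<Sum>a<n. w (r div q * n + a) * T l a (r mod q))" for l r
    have "(\<Sum>r<p * n. \<Sum>s<p * n. conjugate (w r) * M $$ (r, s) * w s)
      = (\<Sum>\<alpha><p. \<Sum>a<n. \<Sum>\<beta><p. \<Sum>i<n. conjugate (w (\<alpha> * n + a)) *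
          (\<Sum>j<q. \<Sum>b<q. K i a j b * V $$ (\<alpha> * q + b, \<beta> * q + j)) * w (\<beta> * n + i))"
      unfolding sum_div_mod by (intro sum.cong refl) (simp add: M block_index_less)
    also have "\<dots> = (\<Sum>\<alpha><p. \<Sum>\<beta><p. \<Sum>a<n. \<Sum>i<n. conjugate (w (\<alpha> * n + a)) *
          (\<Sum>j<q. \<Sum>b<q. K i a j b * V $$ (\<alpha> * q + b, \<beta> * q + j)) * w (\<beta> * n + i))"
      by (intro sum.cong refl sum.swap)
    also have "\<dots> = (\<Sum>\<alpha><p. \<Sum>\<beta><p. \<Sum>l<m. \<Sum>k<m. g l k * (\<Sum>b<q. \<Sum>j<q.
          conjugate (\<xi> l (\<alpha> * q + b)) * V $$ (\<alpha> * q + b, \<beta> * q + j) * \<xi> k (\<beta> * q + j)))"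
      by (subst form_of_factored_map[OF K]) (simp_all add: \<xi>_def)
    also have "\<dots> = (\<Sum>\<alpha><p. \<Sum>l<m. \<Sum>\<beta><p. \<Sum>k<m. g l k * (\<Sum>b<q. \<Sum>j<q.
          conjugate (\<xi> l (\<alpha> * q + b)) * V $$ (\<alpha> * q + b, \<beta> * q + j) * \<xi> k (\<beta> * q + j)))"
      by (intro sum.cong refl sum.swap)
    also have "\<dots> = (\<Sum>l<m. \<Sum>\<alpha><p. \<Sum>\<beta><p. \<Sum>k<m. g l k * (\<Sum>b<q. \<Sum>j<q.
          conjugate (\<xi> l (\<alpha> * q + b)) * V $$ (\<alpha> * q + b, \<beta> * q + j) * \<xi> k (\<beta> * q + j)))"
      by (rule sum.swap)
    also have "\<dots> = (\<Sum>l<m. \<Sum>\<alpha><p. \<Sum>k<m. \<Sum>\<beta><p. g l k * (\<Sum>b<q. \<Sum>j<q.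
          conjugate (\<xi> l (\<alpha> * q + b)) * V $$ (\<alpha> * q + b, \<beta> * q + j) * \<xi> k (\<beta> * q + j)))"
      by (intro sum.cong refl sum.swap)
    also have "\<dots> = (\<Sum>l<m. \<Sum>k<m. \<Sum>\<alpha><p. \<Sum>\<beta><p. g l k * (\<Sum>b<q. \<Sum>j<q.
          conjugate (\<xi> l (\<alpha> * q + b)) * V $$ (\<alpha> * q + b, \<beta> * q + j) * \<xi> k (\<beta> * q + j)))"
      by (intro sum.cong refl sum.swap)
    also have "\<dots> = (\<Sum>l<m. \<Sum>k<m. g l k * (\<Sum>\<alpha><p. \<Sum>\<beta><p. \<Sum>b<q. \<Sum>j<q.
          conjugate (\<xi> l (\<alpha> * q + b)) * V $$ (\<alpha> * q + b, \<beta> * q + j) * \<xi> k (\<beta> * q + j)))"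
      by (simp only: sum_distrib_left)
    also have "\<dots> = (\<Sum>l<m. \<Sum>k<m. g l k * (\<Sum>\<alpha><p. \<Sum>b<q. \<Sum>\<beta><p. \<Sum>j<q.
          conjugate (\<xi> l (\<alpha> * q + b)) * V $$ (\<alpha> * q + b, \<beta> * q + j) * \<xi> k (\<beta> * q + j)))"
      by (intro sum.cong refl arg_cong2[where f="(*)"] sum.swap)
    also have "\<dots> = (\<Sum>l<m. \<Sum>k<m. g l k * (\<Sum>r<p * q. \<Sum>s<p * q.
          conjugate (\<xi> l r) * V $$ (r, s) * \<xi> k s))"
      by (simp only: sum_div_mod)
    finally show "0 \<le> (\<Sum>r<p * n. \<Sum>s<p * n. conjugate (w r) * M $$ (r, s) * w s)"
      using Fejer_sum_nonneg[OF g pos_form_congruence[OF V, of m \<xi>]] by simp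
  qed
  then show "psd (p * n) (of_blocks p n (\<lambda>a b. \<L> (block q q V a b)))"
    unfolding psd_iff_pos_form M_def[symmetric] by (simp add: M_def of_blocks_def)
qed

text \<open>
  This is the positivity of the map at the matrix of rank one with entries \<open>conjugate (x b) * x j\<close>,
  tested against \<open>z\<close>.
\<close>

lemma nonneg_on_product_vectors:
  fixes \<L> :: "'a::form_field mat \<Rightarrow> 'a mat" and m :: nat
  assumes act: "\<And>V a i. V \<in> carrier_mat q q \<Longrightarrow> a < n \<Longrightarrow> i < n \<Longrightarrow>
      \<L> V $$ (a, i) = (\<Sum>j<q. \<Sum>b<q. K i a j b * V $$ (b, j))"
    and K: "\<And>i a j b. i < n \<Longrightarrow> a < n \<Longrightarrow> j < q \<Longrightarrow> b < q \<Longrightarrow>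
      K i a j b = (\<Sum>l<m. \<Sum>k<m. conjugate (T l a b) * g l k * T k i j)"
    and pos: "positive_map q n \<L>"
    and v: "\<And>k. k < m \<Longrightarrow> v k = (\<Sum>a<n. \<Sum>b<q. z a * T k a b * x b)"
  shows "0 \<le> (\<Sum>l<m. \<Sum>k<m. conjugate (v l) * g l k * v k)"
proof -
  define V where "V = mat q q (\<lambda>(b, j). conjugate (x b) * x j)"
  have Vc: "V \<in> carrier_mat q q" by (simp add: V_def)
  have V_entry: "V $$ (b, j) = conjugate (x b) * x j" if "b < q" "j < q" for b j
    using that by (simp add: V_def)
  have "pos_form q (\<lambda>b j. V $$ (b, j))"
    unfolding pos_form_def
  proof (intro conjI allI impI)
    fix b j assume "b < q" "j < q"
    then show "conjugate (V $$ (b, j)) = V $$ (j, b)"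
      by (simp add: V_def conjugate_dist_mul mult.commute)
  next
    fix y :: "nat \<Rightarrow> 'a"
    have "(\<Sum>b<q. \<Sum>j<q. conjugate (y b) * V $$ (b, j) * y j)
      = (\<Sum>b<q. \<Sum>j<q. conjugate (x b * y b) * 1 * (x j * y j))"
      by (intro sum.cong refl) (simp add: V_def conjugate_dist_mul mult_ac)
    also have "\<dots> = conjugate (\<Sum>b<q. x b * y b) * 1 * (\<Sum>b<q. x b * y b)"
      unfolding sum_sandwich[symmetric] by (simp add: sum_conjugate)
    finally show "0 \<le> (\<Sum>b<q. \<Sum>j<q. conjugate (y b) * V $$ (b, j) * y j)"
      using conjugate_square_positive[of "\<Sum>b<q. x b * y b"] by (simp add: mult.commute)
  qed
  then have "psd q V" using Vc by (simp add: psd_iff_pos_form)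
  then have "psd n (\<L> V)" using pos by (simp add: positive_map_def)
  then have "0 \<le> (\<Sum>a<n. \<Sum>i<n. conjugate (z a) * \<L> V $$ (a, i) * z i)"
    by (simp add: psd_iff_pos_form pos_form_nonneg)
  also have "\<dots> = (\<Sum>a<n. \<Sum>i<n. conjugate (z a) *
      (\<Sum>j<q. \<Sum>b<q. K i a j b * (conjugate (x b) * x j)) * z i)"
    by (intro sum.cong refl) (simp add: act[OF Vc] V_entry)
  also have "\<dots> = (\<Sum>l<m. \<Sum>k<m. g l k * (\<Sum>b<q. \<Sum>j<q.
      conjugate (\<Sum>a<n. z a * T l a b) * (conjugate (x b) * x j) * (\<Sum>i<n. z i * T k i j)))"
    by (rule form_of_factored_map[OF K])
  also have "\<dots> = (\<Sum>l<m. \<Sum>k<m. g l k * (\<Sum>b<q. \<Sum>j<q.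
      conjugate ((\<Sum>a<n. z a * T l a b) * x b) * 1 * ((\<Sum>i<n. z i * T k i j) * x j)))"
    by (simp add: conjugate_dist_mul mult_ac)
  also have "\<dots> = (\<Sum>l<m. \<Sum>k<m. g l k *
      (conjugate (\<Sum>b<q. (\<Sum>a<n. z a * T l a b) * x b) * 1 * (\<Sum>j<q. (\<Sum>i<n. z i * T k i j) * x j)))"
    unfolding sum_sandwich[symmetric] by (simp only: sum_conjugate finite_lessThan)
  also have "\<dots> = (\<Sum>l<m. \<Sum>k<m. g l k * (conjugate (v l) * 1 * v k))"
  proof -
    have "(\<Sum>b<q. (\<Sum>a<n. z a * T k a b) * x b) = v k" if "k < m" for k
      unfolding v[OF that] by (subst sum.swap) (simp only: sum_distrib_right)
    then show ?thesis by simp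
  qed
  finally show ?thesis by (simp add: mult_ac)
qed

theorem completely_positive_iff_positive:
  fixes \<L> :: "'a::form_field mat \<Rightarrow> 'a mat"
  assumes st: "star_linear q n \<L>" and L: "is_matricization q n \<L> L"
    and bd: "\<forall>k<m. i k < n \<and> j k < q"
    and inj: "inj_on (\<lambda>k. block n q L (i k) (j k)) {..<m}"
    and C1: "cond_C1 m i j"
    and L0: "L0 \<in> mat_span n q ((\<lambda>k. block n q L (i k) (j k)) ` {..<m})"
    and other: "\<forall>i'<n. \<forall>j'<q. (\<forall>k<m. (i', j') \<noteq> (i k, j k)) \<longrightarrow> block n q L i' j' = L0"
  shows "completely_positive q n \<L> \<longleftrightarrow> positive_map q n \<L>"
proof
  assume "completely_positive q n \<L>"
  then show "positive_map q n \<L>"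
    by (rule positive_if_completely_positive) (rule star_linear_carrier[OF st])
next
  assume pos: "positive_map q n \<L>"
  define K where "K i a j b = L $$ (i * n + a, j * q + b)" for i a j b
  have blk: "block n q L i j $$ (a, b) = K i a j b" if "a < n" "b < q" for i a j b
    using that by (simp add: block_def K_def)
  have act: "\<L> V $$ (a, i) = (\<Sum>j<q. \<Sum>b<q. K i a j b * V $$ (b, j))"
    if "V \<in> carrier_mat q q" "a < n" "i < n" for V a i
    unfolding K_def by (rule matricization_action[OF L that(1) star_linear_carrier[OF st that(1)] that(2,3)])
  have herm: "conjugate (K i a j b) = K a i b j" if "i < n" "a < n" "j < q" "b < q" for i a j b
    unfolding K_def by (rule matricization_hermitian[OF st L]) (use that in auto)
  have bc: "block n q L (i k) (j k) \<in> carrier_mat n q" for k by (simp add: block_def)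
  obtain c where c0: "\<And>a b. a < n \<Longrightarrow> b < q \<Longrightarrow>
      L0 $$ (a, b) = (\<Sum>k<m. c k * block n q L (i k) (j k) $$ (a, b))"
    using span_image_coeffs[OF L0 inj bc] by blast
  have c: "L0 $$ (a, b) = (\<Sum>k<m. c k * K (i k) a (j k) b)" if "a < n" "b < q" for a b
    using c0[OF that] blk[OF that] by simp
  define T where "T = coeff_matrix m i j c"
  define g where "g l k = K (i k) (i l) (j k) (j l)" for l k
  have injp: "inj_on (\<lambda>k. (i k, j k)) {..<m}"
    using inj by (auto simp: inj_on_def)
  have col: "K i' a j' b = (\<Sum>k<m. K (i k) a (j k) b * T k i' j')"
    if ij: "i' < n" "a < n" "j' < q" "b < q" for i' a j' b
  proof (cases "\<exists>l<m. (i', j') = (i l, j l)")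
    case True
    then obtain l where l: "l < m" "i' = i l" "j' = j l" by auto
    have "(\<Sum>k<m. K (i k) a (j k) b * T k i' j') = (\<Sum>k<m. if k = l then K (i k) a (j k) b else 0)"
      using l by (intro sum.cong refl) (simp add: T_def coeff_matrix_chosen[OF injp])
    then show ?thesis using l by simp
  next
    case False
    then have "block n q L i' j' = L0" using other ij by blast
    then have "K i' a j' b = (\<Sum>k<m. c k * K (i k) a (j k) b)"
      using blk[of a b i' j'] c[of a b] ij by simp
    also have "\<dots> = (\<Sum>k<m. K (i k) a (j k) b * T k i' j')"
      using False by (intro sum.cong refl) (simp add: T_def coeff_matrix_other mult.commute)
    finally show ?thesis .
  qed
  \<comment> \<open>the Hermitian symmetry turns the expansion of columns into one of rows\<close>
  have row: "K (i k) a (j k) b = (\<Sum>l<m. conjugate (T l a b) * g l k)"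
    if "k < m" "a < n" "b < q" for k a b
  proof -
    have "K (i k) a (j k) b = conjugate (K a (i k) b (j k))"
      using herm that bd by simp
    also have "K a (i k) b (j k) = (\<Sum>l<m. K (i l) (i k) (j l) (j k) * T l a b)"
      by (rule col) (use that bd in auto)
    also have "conjugate \<dots> = (\<Sum>l<m. conjugate (T l a b) * g l k)"
      using that bd by (simp add: sum_conjugate conjugate_dist_mul herm g_def mult.commute)
    finally show ?thesis .
  qed
  have K: "K i' a j' b = (\<Sum>l<m. \<Sum>k<m. conjugate (T l a b) * g l k * T k i' j')"
    if ij: "i' < n" "a < n" "j' < q" "b < q" for i' a j' b
  proof -
    have "K i' a j' b = (\<Sum>k<m. K (i k) a (j k) b * T k i' j')" by (rule col[OF ij])
    also have "\<dots> = (\<Sum>k<m. \<Sum>l<m. conjugate (T l a b) * g l k * T k i' j')"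
      by (intro sum.cong refl) (simp add: row ij sum_distrib_right)
    also have "\<dots> = (\<Sum>l<m. \<Sum>k<m. conjugate (T l a b) * g l k * T k i' j')"
      by (rule sum.swap)
    finally show ?thesis .
  qed
  obtain P Q where PQ: "star_forest n q i j P Q" "P \<union> Q = {..<m}"
    using star_forest_if_cond_C1[OF C1 bd] .
  have "pos_form m g"
    unfolding pos_form_def
  proof (intro conjI allI impI)
    fix l k assume "l < m" "k < m"
    then show "conjugate (g l k) = g k l" using herm bd by (simp add: g_def)
  next
    fix y
    show "0 \<le> (\<Sum>l<m. \<Sum>k<m. conjugate (y l) * g l k * y k)"
    proof (rule nonneg_from_reachable[OF PQ(1), unfolded PQ(2), where c = c])
      fix v assume "reachable n q i j {..<m} c v"
      then obtain x z where "\<forall>k\<in>{..<m}. v k = z (i k) * x (j k)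
         + c k * ((\<Sum>a<n. z a) * (\<Sum>b<q. x b) - (\<Sum>l<m. z (i l) * x (j l)))"
        unfolding reachable_def by blast
      then have v: "v k = (\<Sum>a<n. \<Sum>b<q. z a * T k a b * x b)" if "k < m" for k
        unfolding T_def using coeff_matrix_product_vector[OF bd that, of z c x] that by simp
      show "0 \<le> (\<Sum>l<m. \<Sum>k<m. conjugate (v l) * g l k * v k)"
        by (rule nonneg_on_product_vectors[OF act K pos v])
    qed
  qed
  from completely_positive_if_factored[OF act herm K this]
  show "completely_positive q n \<L>" .
qed

theorem theorem1p1:
  shows
    "(\<forall>(q::nat) (n::nat) (m::nat) (\<L> :: complex mat \<Rightarrow> complex mat) (L :: complex mat)
        (i :: nat \<Rightarrow> nat) (j :: nat \<Rightarrow> nat) (L0 :: complex mat).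
        star_linear q n \<L> \<longrightarrow>
        is_matricization q n \<L> L \<longrightarrow>
        m = vec_space.rank (n * q) (choi q n \<L>) \<longrightarrow>
        (\<forall>k<m. i k < n \<and> j k < q) \<longrightarrow>
        lin_indpt_family n q m (\<lambda>k. block n q L (i k) (j k)) \<longrightarrow>
        cond_C1 m i j \<longrightarrow>
        L0 \<in> mat_span n q ((\<lambda>k. block n q L (i k) (j k)) ` {..<m}) \<longrightarrow>
        (\<forall>i'<n. \<forall>j'<q. (\<forall>k<m. (i', j') \<noteq> (i k, j k)) \<longrightarrow> block n q L i' j' = L0) \<longrightarrow>
        (completely_positive q n \<L> \<longleftrightarrow> positive_map q n \<L>))
   \<and> (\<forall>(q::nat) (n::nat) (m::nat) (\<L> :: real mat \<Rightarrow> real mat) (L :: real mat)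
        (i :: nat \<Rightarrow> nat) (j :: nat \<Rightarrow> nat) (L0 :: real mat).
        star_linear q n \<L> \<longrightarrow>
        is_matricization q n \<L> L \<longrightarrow>
        m = vec_space.rank (n * q) (choi q n \<L>) \<longrightarrow>
        (\<forall>k<m. i k < n \<and> j k < q) \<longrightarrow>
        lin_indpt_family n q m (\<lambda>k. block n q L (i k) (j k)) \<longrightarrow>
        cond_C1 m i j \<longrightarrow>
        L0 \<in> mat_span n q ((\<lambda>k. block n q L (i k) (j k)) ` {..<m}) \<longrightarrow>
        (\<forall>i'<n. \<forall>j'<q. (\<forall>k<m. (i', j') \<noteq> (i k, j k)) \<longrightarrow> block n q L i' j' = L0) \<longrightarrow>
        (completely_positive q n \<L> \<longleftrightarrow> positive_map q n \<L>))"
  unfolding lin_indpt_family_def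
  by (intro conjI allI impI; elim conjE; rule completely_positive_iff_positive; assumption)

end
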